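(* 1. Let $(B,F)$ be a stable Boolean partition algebra. Then $S^{*}(B,F)$ is a complete partition space. 2. If $(X,M)$ is a partition space, then $\mathfrak{B}^{*}(X,M)$ is a subcomplete and stable Boolean partition algebra. 3. Let $(B,F)$ be a stable Boolean partition algebra. Then $\psi:(B,F)\rightarrow\mathfrak{B}^{*}(S^{*}(B,F))$, $\psi(b)=\{\mathcal{U}\in S^{*}(B,F)\mid b\in\mathcal{U}\}$, is an injective partition homomorphism, and if $(B,F)$ is also subcomplete, then $\psi$ is a partition isomorphism. 4. Let $(X,M)$ be a partition space. Then the map $\mathcal{C}:(X,M)\rightarrow S^{*}(\mathfrak{B}^{*}(X,M))$, $\mathcal{C}(x)=\{R\in\{\emptyset\}\cup\bigcup M\mid x\in R\}$, is uniformly continuous, and its image $\mathcal{C}[X]$ is dense in $S^{*}(\mathfrak{B}^{*}(X,M))$. If $(X,M)$ is separated, then $\mathcal{C}$ is a uniform embedding. If $(X,M)$ is complete, then $\mathcal{C}$ is a uniform homeomorphism (an isomorphism of uniform spaces).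
   Context: Partitions. For a Boolean algebra $B$ (complement of $b$ written $b'$), a partition of $B$ is a subset $p\subseteq B\setminus\{0\}$ with $a\wedge b=0$ for distinct $a,b\in p$ and with least upper bound $\bigvee p=1$. $\mathbb{P}(B)$ is the set of all partitions of $B$, ordered by $p\preceq q$ iff for each $a\in p$ there is $b\in q$ with $a\leq b$; this $b$ is unique and is denoted $\phi_{p,q}(a)$. Under $\preceq$, $\mathbb{P}(B)$ is a meet-semilattice with $p\wedge q=\{a\wedge b\mid a\in p,b\in q,a\wedge b\neq 0\}$. A filter on $\mathbb{P}(B)$ is a nonempty subset closed under $\wedge$ and upward closed under $\preceq$ (it may be all of $\mathbb{P}(B)$). A partition $p$ of $B$ is subcomplete if $\bigvee r$ exists in $B$ for every $r\subseteq p$. Boolean partition algebras. A Boolean partition algebra is a pair $(B,F)$ with $B$ a Boolean algebra and $F$ a filter on $\mathbb{P}(B)$ such that $\{b,b'\}\in F$ for each $b\in B\setminus\{0,1\}$. It is subcomplete if every $p\in F$ is subcomplete. $\varprojlim F$ denotes the set of all families $(x_{p})_{p\in F}$ with $x_{p}\in p$ and $\phi_{p,q}(x_{p})=x_{q}$ whenever $p\preceq q$ in $F$. $(B,F)$ is stable if for each $b\in B\setminus\{0\}$ there are $(x_{p})_{p\in F}\in\varprojlim F$ and $p\in F$ with $x_{p}=b$. A partition homomorphism $f:(A,F)\to(B,G)$ is a Boolean algebra homomorphism $f:A\to B$ with $f[p]\setminus\{0\}\in G$ for each $p\in F$; a partition isomorphism is a bijective partition homomorphism whose inverse is a partition homomorphism.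 Partition spaces. For a set $X$, partitions of the Boolean algebra of all subsets $P(X)$ are the usual partitions of the set $X$. A partition space is a pair $(X,M)$ with $M$ a filter on $\mathbb{P}(P(X))$. It is regarded as the (non-Archimedean) uniform space on $X$ whose uniformity is generated by the equivalence relations whose classes are the blocks of $P$, $P\in M$; the topology is that of this uniformity. $(X,M)$ is separated (separating) if for distinct $x,y\in X$ some $P\in M$ has $x,y$ in different blocks. $(X,M)$ is complete if it is separated and every Cauchy filter converges. A map $f:(X,M)\to(Y,N)$ is uniformly continuous iff $\{f^{-1}(R)\mid R\in Q\}\setminus\{\emptyset\}\in M$ for each $Q\in N$. The two constructions. For a Boolean partition algebra $(B,F)$, an $F$-ultrafilter is an ultrafilter $\mathcal{U}$ on $B$ with $|\mathcal{U}\cap p|=1$ for each $p\in F$; $S^{*}(B,F)$ is the set of all $F$-ultrafilters on $B$, and $\iota(a)=\{\mathcal{U}\in S^{*}(B,F)\mid a\in\mathcal{U}\}$ for $a\in B$. When $(B,F)$ is stable, $S^{*}(B,F)$ is given the partition space structure generated by $\{\iota[p]\mid p\in F\}$, i.e. the set of all partitions $Z$ of $S^{*}(B,F)$ with $\iota[p]\preceq Z$ for some $p\in F$. For a partition space $(X,M)$, $\mathfrak{B}^{*}(X,M)$ is the pair $(\{\emptyset\}\cup\bigcup M,\,M)$, where $\{\emptyset\}\cup\bigcup M$ is a subalgebra of $P(X)$. *)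

theory Defs
  imports "HOL-Algebra.Complete_Lattice" "HOL-Analysis.Abstract_Limits" "HOL-Library.Disjoint_Sets"
begin

section \<open>Boolean algebras\<close>

text \<open>
  The algebra \<open>{\<emptyset>} \<union> \<Union>M\<close> of sets attached to a partition space is not a whole type, so Boolean
  algebras are carrier-based: bounded distributive complemented lattices in the sense of
  HOL-Algebra. The one-element Boolean algebra is allowed; it is the power set algebra of the
  empty set.
\<close>

locale boolean_lattice = bounded_lattice B for B (structure) +
  assumes meet_join_distrib:
      "\<lbrakk>x \<in> carrier B; y \<in> carrier B; z \<in> carrier B\<rbrakk> \<Longrightarrow> x \<sqinter> (y \<squnion> z) = (x \<sqinter> y) \<squnion> (x \<sqinter> z)"
    and complement_exists:
      "x \<in> carrier B \<Longrightarrow> \<exists>y\<in>carrier B. x \<sqinter> y = \<bottom> \<and> x \<squnion> y = \<top>"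

definition complement :: "'a gorder \<Rightarrow> 'a \<Rightarrow> 'a" where
  "complement B b = (THE c. c \<in> carrier B \<and> b \<sqinter>\<^bsub>B\<^esub> c = \<bottom>\<^bsub>B\<^esub> \<and> b \<squnion>\<^bsub>B\<^esub> c = \<top>\<^bsub>B\<^esub>)"

definition boolean_hom :: "'a gorder \<Rightarrow> 'b gorder \<Rightarrow> ('a \<Rightarrow> 'b) \<Rightarrow> bool" where
  "boolean_hom A B f \<longleftrightarrow>
     f \<in> carrier A \<rightarrow> carrier B \<and>
     (\<forall>x\<in>carrier A. \<forall>y\<in>carrier A. f (x \<sqinter>\<^bsub>A\<^esub> y) = f x \<sqinter>\<^bsub>B\<^esub> f y) \<and>
     (\<forall>x\<in>carrier A. \<forall>y\<in>carrier A. f (x \<squnion>\<^bsub>A\<^esub> y) = f x \<squnion>\<^bsub>B\<^esub> f y) \<and>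
     (\<forall>x\<in>carrier A. f (complement A x) = complement B (f x)) \<and>
     f \<bottom>\<^bsub>A\<^esub> = \<bottom>\<^bsub>B\<^esub> \<and> f \<top>\<^bsub>A\<^esub> = \<top>\<^bsub>B\<^esub>"

definition proper_filter :: "'a gorder \<Rightarrow> 'a set \<Rightarrow> bool" where
  "proper_filter B U \<longleftrightarrow>
     U \<subseteq> carrier B \<and> U \<noteq> {} \<and> \<bottom>\<^bsub>B\<^esub> \<notin> U \<and>
     (\<forall>a\<in>U. \<forall>b\<in>U. a \<sqinter>\<^bsub>B\<^esub> b \<in> U) \<and>
     (\<forall>a\<in>U. \<forall>b\<in>carrier B. a \<sqsubseteq>\<^bsub>B\<^esub> b \<longrightarrow> b \<in> U)"

definition ultrafilter :: "'a gorder \<Rightarrow> 'a set \<Rightarrow> bool" where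
  "ultrafilter B U \<longleftrightarrow> proper_filter B U \<and> (\<forall>V. proper_filter B V \<and> U \<subseteq> V \<longrightarrow> V = U)"

definition powerset_algebra :: "'a set \<Rightarrow> 'a set gorder" where
  "powerset_algebra X = \<lparr>carrier = Pow X, eq = (=), le = (\<subseteq>)\<rparr>"


section \<open>Partitions\<close>

definition partitions :: "'a gorder \<Rightarrow> 'a set set" where
  "partitions B =
     {p. p \<subseteq> carrier B - {\<bottom>\<^bsub>B\<^esub>} \<and>
         (\<forall>a\<in>p. \<forall>b\<in>p. a \<noteq> b \<longrightarrow> a \<sqinter>\<^bsub>B\<^esub> b = \<bottom>\<^bsub>B\<^esub>) \<and>
         least B \<top>\<^bsub>B\<^esub> (Upper B p)}"

definition finer :: "'a gorder \<Rightarrow> 'a set \<Rightarrow> 'a set \<Rightarrow> bool" where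
  "finer B p q \<longleftrightarrow> (\<forall>a\<in>p. \<exists>b\<in>q. a \<sqsubseteq>\<^bsub>B\<^esub> b)"

text \<open>The map \<open>\<phi>\<^bsub>p,q\<^esub>\<close>, meaningful for \<open>p\<close> finer than \<open>q\<close> and \<open>a \<in> p\<close>.\<close>

definition bonding_map :: "'a gorder \<Rightarrow> 'a set \<Rightarrow> 'a set \<Rightarrow> 'a \<Rightarrow> 'a" where
  "bonding_map B p q a = (THE b. b \<in> q \<and> a \<sqsubseteq>\<^bsub>B\<^esub> b)"

definition partition_meet :: "'a gorder \<Rightarrow> 'a set \<Rightarrow> 'a set \<Rightarrow> 'a set" where
  "partition_meet B p q = {a \<sqinter>\<^bsub>B\<^esub> b | a b. a \<in> p \<and> b \<in> q \<and> a \<sqinter>\<^bsub>B\<^esub> b \<noteq> \<bottom>\<^bsub>B\<^esub>}"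

definition partition_filter :: "'a gorder \<Rightarrow> 'a set set \<Rightarrow> bool" where
  "partition_filter B F \<longleftrightarrow>
     F \<subseteq> partitions B \<and> F \<noteq> {} \<and>
     (\<forall>p\<in>F. \<forall>q\<in>F. partition_meet B p q \<in> F) \<and>
     (\<forall>p\<in>F. \<forall>q\<in>partitions B. finer B p q \<longrightarrow> q \<in> F)"

definition subcomplete_partition :: "'a gorder \<Rightarrow> 'a set \<Rightarrow> bool" where
  "subcomplete_partition B p \<longleftrightarrow> (\<forall>r\<subseteq>p. \<exists>s. least B s (Upper B r))"


section \<open>Boolean partition algebras\<close>

type_synonym 'a boolean_partition_structure = "'a gorder \<times> 'a set set"

fun boolean_partition_algebra :: "'a boolean_partition_structure \<Rightarrow> bool" where
  "boolean_partition_algebra (B, F) \<longleftrightarrow>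
     boolean_lattice B \<and> partition_filter B F \<and>
     (\<forall>b\<in>carrier B - {\<bottom>\<^bsub>B\<^esub>, \<top>\<^bsub>B\<^esub>}. {b, complement B b} \<in> F)"

fun subcomplete :: "'a boolean_partition_structure \<Rightarrow> bool" where
  "subcomplete (B, F) \<longleftrightarrow> (\<forall>p\<in>F. subcomplete_partition B p)"

fun inverse_limit :: "'a boolean_partition_structure \<Rightarrow> ('a set \<Rightarrow> 'a) set" where
  "inverse_limit (B, F) =
     {x \<in> (\<Pi>\<^sub>E p\<in>F. p). \<forall>p\<in>F. \<forall>q\<in>F. finer B p q \<longrightarrow> bonding_map B p q (x p) = x q}"

fun stable :: "'a boolean_partition_structure \<Rightarrow> bool" where
  "stable (B, F) \<longleftrightarrow>
     (\<forall>b\<in>carrier B - {\<bottom>\<^bsub>B\<^esub>}. \<exists>x\<in>inverse_limit (B, F). \<exists>p\<in>F. x p = b)"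

fun partition_hom ::
  "'a boolean_partition_structure \<Rightarrow> 'b boolean_partition_structure \<Rightarrow> ('a \<Rightarrow> 'b) \<Rightarrow> bool" where
  "partition_hom (A, F) (B, G) f \<longleftrightarrow>
     boolean_hom A B f \<and> (\<forall>p\<in>F. f ` p - {\<bottom>\<^bsub>B\<^esub>} \<in> G)"

definition partition_iso ::
  "'a boolean_partition_structure \<Rightarrow> 'b boolean_partition_structure \<Rightarrow> ('a \<Rightarrow> 'b) \<Rightarrow> bool" where
  "partition_iso \<A> \<B> f \<longleftrightarrow>
     bij_betw f (carrier (fst \<A>)) (carrier (fst \<B>)) \<and>
     partition_hom \<A> \<B> f \<and>
     partition_hom \<B> \<A> (inv_into (carrier (fst \<A>)) f)"


section \<open>Uniform spaces on a carrier\<close>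

text \<open>
  The type class of uniform spaces lives on whole types; here a uniform space is a carrier
  together with a filter of entourages concentrated on the square of the carrier. The notions
  below copy those of the type class.
\<close>

type_synonym 'a uniform_structure = "'a set \<times> ('a \<times> 'a) filter"

fun uniform_topology :: "'a uniform_structure \<Rightarrow> 'a topology" where
  "uniform_topology (X, \<U>) =
     topology (\<lambda>V. V \<subseteq> X \<and> (\<forall>x\<in>V. eventually (\<lambda>(x', y). x' = x \<longrightarrow> y \<in> V) \<U>))"

fun cauchy_filter_in :: "'a uniform_structure \<Rightarrow> 'a filter \<Rightarrow> bool" where
  "cauchy_filter_in (X, \<U>) \<F> \<longleftrightarrow> \<F> \<noteq> bot \<and> \<F> \<le> principal X \<and> \<F> \<times>\<^sub>F \<F> \<le> \<U>"

definition uniform_complete :: "'a uniform_structure \<Rightarrow> bool" where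
  "uniform_complete S \<longleftrightarrow>
     (\<forall>\<F>. cauchy_filter_in S \<F> \<longrightarrow> (\<exists>x\<in>fst S. \<F> \<le> nhdsin (uniform_topology S) x))"

fun uniformly_continuous ::
  "'a uniform_structure \<Rightarrow> 'b uniform_structure \<Rightarrow> ('a \<Rightarrow> 'b) \<Rightarrow> bool" where
  "uniformly_continuous (X, \<U>) (Y, \<V>) f \<longleftrightarrow>
     f \<in> X \<rightarrow> Y \<and> filterlim (\<lambda>(x, y). (f x, f y)) \<V> \<U>"

definition uniform_homeomorphism ::
  "'a uniform_structure \<Rightarrow> 'b uniform_structure \<Rightarrow> ('a \<Rightarrow> 'b) \<Rightarrow> bool" where
  "uniform_homeomorphism S T f \<longleftrightarrow>
     bij_betw f (fst S) (fst T) \<and>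
     uniformly_continuous S T f \<and> uniformly_continuous T S (inv_into (fst S) f)"

fun uniform_subspace :: "'a uniform_structure \<Rightarrow> 'a set \<Rightarrow> 'a uniform_structure" where
  "uniform_subspace (X, \<U>) A = (A, Lattices.inf \<U> (principal (A \<times> A)))"

definition uniform_embedding ::
  "'a uniform_structure \<Rightarrow> 'b uniform_structure \<Rightarrow> ('a \<Rightarrow> 'b) \<Rightarrow> bool" where
  "uniform_embedding S T f \<longleftrightarrow>
     f \<in> fst S \<rightarrow> fst T \<and> uniform_homeomorphism S (uniform_subspace T (f ` fst S)) f"


section \<open>Partition spaces\<close>

type_synonym 'a partition_structure = "'a set \<times> 'a set set set"

fun partition_space :: "'a partition_structure \<Rightarrow> bool" where
  "partition_space (X, M) \<longleftrightarrow> partition_filter (powerset_algebra X) M"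

fun uniform_of :: "'a partition_structure \<Rightarrow> 'a uniform_structure" where
  "uniform_of (X, M) = (X, INF P\<in>M. principal {(x, y). \<exists>R\<in>P. x \<in> R \<and> y \<in> R})"

text \<open>
  For a partition space, the blockwise description of uniform continuity is
  \<open>uniformly_continuous_iff\<close> below.
\<close>

fun separated :: "'a partition_structure \<Rightarrow> bool" where
  "separated (X, M) \<longleftrightarrow>
     (\<forall>x\<in>X. \<forall>y\<in>X. x \<noteq> y \<longrightarrow> (\<exists>P\<in>M. \<not> (\<exists>R\<in>P. x \<in> R \<and> y \<in> R)))"

definition complete_space :: "'a partition_structure \<Rightarrow> bool" where
  "complete_space S \<longleftrightarrow> separated S \<and> uniform_complete (uniform_of S)"


section \<open>The two constructions\<close>

fun F_ultrafilters :: "'a boolean_partition_structure \<Rightarrow> 'a set set" where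
  "F_ultrafilters (B, F) = {U. ultrafilter B U \<and> (\<forall>p\<in>F. card (U \<inter> p) = 1)}"

text \<open>The map \<open>iota (B, F)\<close> is also the map \<open>\<psi>\<close> from \<open>(B, F)\<close> to \<open>B_star (S_star (B, F))\<close>.\<close>

definition iota :: "'a boolean_partition_structure \<Rightarrow> 'a \<Rightarrow> 'a set set" where
  "iota \<B> a = {U \<in> F_ultrafilters \<B>. a \<in> U}"

text \<open>
  The set \<open>iota (B, F) ` p\<close> is a partition of the set of \<open>F\<close>-ultrafilters only for stable
  \<open>(B, F)\<close>; without stability the definition below is a default value.
\<close>

fun S_star :: "'a boolean_partition_structure \<Rightarrow> 'a set partition_structure" where
  "S_star (B, F) =
     (F_ultrafilters (B, F),
      {Z \<in> partitions (powerset_algebra (F_ultrafilters (B, F))).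
         \<exists>p\<in>F. finer (powerset_algebra (F_ultrafilters (B, F))) (iota (B, F) ` p) Z})"

fun B_star :: "'a partition_structure \<Rightarrow> 'a set boolean_partition_structure" where
  "B_star (X, M) = (\<lparr>carrier = {{}} \<union> \<Union>M, eq = (=), le = (\<subseteq>)\<rparr>, M)"

definition point_ultrafilter :: "'a partition_structure \<Rightarrow> 'a \<Rightarrow> 'a set set" where
  "point_ultrafilter S x = {R \<in> carrier (fst (B_star S)). x \<in> R}"


section \<open>Agreement with the set-theoretic descriptions\<close>

lemma carrier_powerset [simp]: "carrier (powerset_algebra X) = Pow X"
  and le_powerset [simp]: "le (powerset_algebra X) = (\<subseteq>)"
  by (simp_all add: powerset_algebra_def)

lemma bottom_powerset [simp]: "\<bottom>\<^bsub>powerset_algebra X\<^esub> = {}"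
  unfolding bottom_def least_def by (rule some_equality) auto

lemma top_powerset [simp]: "\<top>\<^bsub>powerset_algebra X\<^esub> = X"
  unfolding top_def greatest_def by (rule some_equality) auto

lemma meet_powerset:
  assumes "R \<subseteq> X" "S \<subseteq> X"
  shows "R \<sqinter>\<^bsub>powerset_algebra X\<^esub> S = R \<inter> S"
proof -
  have Lower: "Lower (powerset_algebra X) {R, S} = Pow (R \<inter> S)"
    using assms by (auto simp: Lower_def)
  have "greatest (powerset_algebra X) G (Pow (R \<inter> S)) \<longleftrightarrow> G = R \<inter> S" for G
  proof
    assume "greatest (powerset_algebra X) G (Pow (R \<inter> S))"
    then have "G \<subseteq> R \<inter> S" "R \<inter> S \<subseteq> G" by (simp_all add: greatest_def)
    then show "G = R \<inter> S" by (rule subset_antisym)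
  next
    assume "G = R \<inter> S"
    moreover have "Pow (R \<inter> S) \<subseteq> Pow X" using assms by blast
    ultimately show "greatest (powerset_algebra X) G (Pow (R \<inter> S))" by (simp add: greatest_def)
  qed
  then show ?thesis by (simp add: meet_def inf_def Lower)
qed

lemma partitions_powerset: "partitions (powerset_algebra X) = {P. partition_on X P}"
proof -
  have "P \<in> partitions (powerset_algebra X) \<longleftrightarrow> partition_on X P" for P
  proof
    assume P: "P \<in> partitions (powerset_algebra X)"
    then have sub: "P \<subseteq> Pow X - {{}}"
      and l: "least (powerset_algebra X) X (Upper (powerset_algebra X) P)"
      unfolding partitions_def by simp_all
    have disj: "a \<inter> b = {}" if "a \<in> P" "b \<in> P" "a \<noteq> b" for a b
    proof -
      have "a \<inter> b = a \<sqinter>\<^bsub>powerset_algebra X\<^esub> b"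
        using sub that by (intro meet_powerset[symmetric]) auto
      with P that show ?thesis by (simp add: partitions_def)
    qed
    from sub have "\<Union>P \<in> Upper (powerset_algebra X) P"
      by (auto simp: Upper_def)
    with l have "X \<subseteq> \<Union>P" by (simp add: least_def)
    with sub disj show "partition_on X P"
      by (auto simp: partition_on_def disjoint_def)
  next
    assume P: "partition_on X P"
    then have sub: "P \<subseteq> Pow X - {{}}" and U: "\<Union>P = X"
      by (auto simp: partition_on_def)
    have "a \<sqinter>\<^bsub>powerset_algebra X\<^esub> b = {}" if "a \<in> P" "b \<in> P" "a \<noteq> b" for a b
    proof -
      have "a \<sqinter>\<^bsub>powerset_algebra X\<^esub> b = a \<inter> b" using sub that by (intro meet_powerset) auto
      with P that show ?thesis by (auto simp: partition_on_def disjoint_def)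
    qed
    moreover have "least (powerset_algebra X) X (Upper (powerset_algebra X) P)"
      using U by (auto simp: least_def Upper_def)
    ultimately show "P \<in> partitions (powerset_algebra X)"
      using sub by (simp add: partitions_def)
  qed
  then show ?thesis by blast
qed

lemma openin_uniform_topology:
  "openin (uniform_topology (X, \<U>)) V \<longleftrightarrow>
     V \<subseteq> X \<and> (\<forall>x\<in>V. eventually (\<lambda>(x', y). x' = x \<longrightarrow> y \<in> V) \<U>)"
proof -
  have "istopology (\<lambda>V. V \<subseteq> X \<and> (\<forall>x\<in>V. eventually (\<lambda>(x', y). x' = x \<longrightarrow> y \<in> V) \<U>))"
    unfolding istopology_def
  proof (intro conjI allI impI)
    fix S T assume "S \<subseteq> X \<and> (\<forall>x\<in>S. \<forall>\<^sub>F (x', y) in \<U>. x' = x \<longrightarrow> y \<in> S)"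
      "T \<subseteq> X \<and> (\<forall>x\<in>T. \<forall>\<^sub>F (x', y) in \<U>. x' = x \<longrightarrow> y \<in> T)"
    then have "\<forall>\<^sub>F (x', y) in \<U>. x' = x \<longrightarrow> y \<in> S" "\<forall>\<^sub>F (x', y) in \<U>. x' = x \<longrightarrow> y \<in> T"
      if "x \<in> S \<inter> T" for x
      using that by auto
    then show "\<forall>x\<in>S \<inter> T. \<forall>\<^sub>F (x', y) in \<U>. x' = x \<longrightarrow> y \<in> S \<inter> T"
      by (intro ballI) (rule eventually_elim2, assumption+, auto)
  next
    fix K assume "\<forall>S\<in>K. S \<subseteq> X \<and> (\<forall>x\<in>S. \<forall>\<^sub>F (x', y) in \<U>. x' = x \<longrightarrow> y \<in> S)"
    then have "\<forall>\<^sub>F (x', y) in \<U>. x' = x \<longrightarrow> y \<in> S" if "S \<in> K" "x \<in> S" for S x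
      using that by simp
    then show "\<forall>x\<in>\<Union>K. \<forall>\<^sub>F (x', y) in \<U>. x' = x \<longrightarrow> y \<in> \<Union>K"
      by (intro ballI, elim UnionE) (rule eventually_mono, assumption, auto)
  qed auto
  then show ?thesis by (simp add: topology_inverse')
qed

lemma eventually_uniform_of:
  assumes "partition_space (X, M)"
  shows "eventually E (snd (uniform_of (X, M))) \<longleftrightarrow>
           (\<exists>P\<in>M. \<forall>R\<in>P. \<forall>x\<in>R. \<forall>y\<in>R. E (x, y))"
proof -
  let ?e = "\<lambda>P. {(x, y). \<exists>R\<in>P. x \<in> R \<and> y \<in> R}"
  have M: "M \<noteq> {}" "\<And>P Q. P \<in> M \<Longrightarrow> Q \<in> M \<Longrightarrow> partition_meet (powerset_algebra X) P Q \<in> M"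
    using assms by (simp_all add: partition_filter_def)
  have "M \<subseteq> {P. partition_on X P}"
    using assms by (simp add: partition_filter_def partitions_powerset)
  then have M3: "\<And>P R. P \<in> M \<Longrightarrow> R \<in> P \<Longrightarrow> R \<subseteq> X"
    by (auto simp: partition_on_def)
  have dir: "\<exists>C\<in>M. principal (?e C) \<le> Lattices.inf (principal (?e P)) (principal (?e Q))"
    if "P \<in> M" "Q \<in> M" for P Q
  proof (intro bexI)
    show "partition_meet (powerset_algebra X) P Q \<in> M" using M(2) that .
    have "?e (partition_meet (powerset_algebra X) P Q) \<subseteq> ?e P \<inter> ?e Q"
    proof clarify
      fix x y A assume A: "A \<in> partition_meet (powerset_algebra X) P Q" "x \<in> A" "y \<in> A"
      then obtain R S where RS: "R \<in> P" "S \<in> Q" and "A = R \<sqinter>\<^bsub>powerset_algebra X\<^esub> S"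
        by (auto simp: partition_meet_def)
      moreover have "R \<subseteq> X" "S \<subseteq> X" using M3 RS that by blast+
      ultimately have "A = R \<inter> S" by (simp add: meet_powerset)
      with A RS show "(x, y) \<in> ?e P \<inter> ?e Q" by blast
    qed
    then show "principal (?e (partition_meet (powerset_algebra X) P Q))
                 \<le> Lattices.inf (principal (?e P)) (principal (?e Q))"
      by simp
  qed
  have "eventually E (INF P\<in>M. principal (?e P)) \<longleftrightarrow> (\<exists>P\<in>M. eventually E (principal (?e P)))"
    by (rule eventually_INF_base[OF M(1) dir])
  also have "\<dots> \<longleftrightarrow> (\<exists>P\<in>M. \<forall>R\<in>P. \<forall>x\<in>R. \<forall>y\<in>R. E (x, y))"
    unfolding eventually_principal by (intro bex_cong refl) fast
  finally show ?thesis by simp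
qed

lemma uniformly_continuous_iff:
  assumes "partition_space (X, M)" "partition_space (Y, N)" "f \<in> X \<rightarrow> Y"
  shows "uniformly_continuous (uniform_of (X, M)) (uniform_of (Y, N)) f \<longleftrightarrow>
           (\<forall>Q\<in>N. {f -` R \<inter> X | R. R \<in> Q} - {{}} \<in> M)" (is "?L \<longleftrightarrow> ?R")
proof -
  let ?inv = "\<lambda>Q. {f -` R \<inter> X | R. R \<in> Q} - {{}}"
  have part: "partition_on X P" if "P \<in> M" for P
    using assms(1) that partitions_powerset by (auto simp: partition_filter_def)
  have partN: "partition_on Y Q" if "Q \<in> N" for Q
    using assms(2) that partitions_powerset by (auto simp: partition_filter_def)
  have inv: "partition_on X (?inv Q)" if "Q \<in> N" for Q
    using partN[OF that] assms(3) by (auto simp: partition_on_def disjoint_def; blast)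
  have key: "?inv Q \<in> M \<longleftrightarrow> (\<exists>P\<in>M. \<forall>R\<in>P. \<forall>x\<in>R. \<forall>y\<in>R. \<exists>S\<in>Q. f x \<in> S \<and> f y \<in> S)"
    if Q: "Q \<in> N" for Q
  proof
    assume "?inv Q \<in> M"
    then show "\<exists>P\<in>M. \<forall>R\<in>P. \<forall>x\<in>R. \<forall>y\<in>R. \<exists>S\<in>Q. f x \<in> S \<and> f y \<in> S"
      by (rule bexI[rotated]) blast
  next
    assume "\<exists>P\<in>M. \<forall>R\<in>P. \<forall>x\<in>R. \<forall>y\<in>R. \<exists>S\<in>Q. f x \<in> S \<and> f y \<in> S"
    then obtain P where P: "P \<in> M"
      and all: "\<forall>R\<in>P. \<forall>x\<in>R. \<forall>y\<in>R. \<exists>S\<in>Q. f x \<in> S \<and> f y \<in> S"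
      by (elim bexE)
    have *: "\<exists>S\<in>Q. f x \<in> S \<and> f y \<in> S" if "R \<in> P" "x \<in> R" "y \<in> R" for R x y
      using all that by simp
    have "\<exists>S\<in>?inv Q. R \<subseteq> S" if R: "R \<in> P" for R
    proof -
      have "R \<noteq> {}" using part[OF P] R by (auto simp: partition_on_def)
      then obtain x where x: "x \<in> R" by auto
      obtain S where S: "S \<in> Q" "f x \<in> S" using *[OF R x x] by blast
      have "y \<in> f -` S \<inter> X" if y: "y \<in> R" for y
      proof -
        obtain T where "T \<in> Q" "f x \<in> T" "f y \<in> T" using *[OF R x y] by blast
        moreover from this S have "T = S"
          using disjointD[OF partition_onD2[OF partN[OF Q]]] by (metis IntI empty_iff)
        ultimately have "f y \<in> S" by simp
        moreover have "y \<in> X" using part[OF P] R y by (auto simp: partition_on_def)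
        ultimately show ?thesis by simp
      qed
      then have "R \<subseteq> f -` S \<inter> X" by (rule subsetI)
      moreover from this x have "f -` S \<inter> X \<in> ?inv Q" using S(1) by auto
      ultimately show ?thesis by (rule bexI)
    qed
    then have fin: "finer (powerset_algebra X) P (?inv Q)" by (simp add: finer_def)
    have up: "\<forall>p\<in>M. \<forall>q. partition_on X q \<longrightarrow> finer (powerset_algebra X) p q \<longrightarrow> q \<in> M"
      using assms(1) by (simp add: partition_filter_def partitions_powerset)
    show "?inv Q \<in> M"
      by (rule up[rule_format, OF P inv[OF Q] fin])
  qed
  have "?L \<longleftrightarrow> (\<forall>Q\<in>N. eventually (\<lambda>(x, y). \<exists>S\<in>Q. f x \<in> S \<and> f y \<in> S) (snd (uniform_of (X, M))))"
    unfolding uniform_of.simps uniformly_continuous.simps filterlim_INF filterlim_principal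
    using assms(3) by (simp only: simp_thms split_beta' mem_Collect_eq fst_conv snd_conv)
  also have "\<dots> \<longleftrightarrow>
      (\<forall>Q\<in>N. \<exists>P\<in>M. \<forall>R\<in>P. \<forall>x\<in>R. \<forall>y\<in>R. \<exists>S\<in>Q. f x \<in> S \<and> f y \<in> S)"
    by (simp only: eventually_uniform_of[OF assms(1)] prod.case)
  also have "\<dots> \<longleftrightarrow> ?R"
    by (intro ball_cong refl key[symmetric])
  finally show ?thesis .
qed

lemma B_star_subalgebra:
  assumes "partition_space (X, M)" and R: "R \<in> carrier (fst (B_star (X, M)))"
    and S: "S \<in> carrier (fst (B_star (X, M)))"
  shows "R \<subseteq> X" "X - R \<in> carrier (fst (B_star (X, M)))" "R \<inter> S \<in> carrier (fst (B_star (X, M)))"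
proof -
  have part: "partition_on X P" if "P \<in> M" for P
    using assms(1) that partitions_powerset by (auto simp: partition_filter_def)
  have up: "Q \<in> M" if "P \<in> M" "partition_on X Q" "\<forall>A\<in>P. \<exists>B\<in>Q. A \<subseteq> B" for P Q
    using assms(1) that by (auto simp: partition_filter_def finer_def partitions_powerset)
  have meet: "partition_meet (powerset_algebra X) P Q \<in> M" if "P \<in> M" "Q \<in> M" for P Q
    using assms(1) that by (auto simp: partition_filter_def)
  show "R \<subseteq> X" using R part by (auto simp: partition_on_def)
  obtain P0 where P0: "P0 \<in> M" using assms(1) by (auto simp: partition_filter_def)
  show "X - R \<in> carrier (fst (B_star (X, M)))"
  proof (cases "R = {} \<or> R = X")
    case True
    have "{X} \<in> M" if "X \<noteq> {}"
      using up[OF P0 partition_on_space[OF that]] part[OF P0] by (auto simp: partition_on_def)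
    with True show ?thesis by auto
  next
    case False
    with R obtain P where P: "P \<in> M" "R \<in> P" by auto
    have "{R, X - R} \<in> M"
    proof (rule up[OF P(1)])
      show "partition_on X {R, X - R}"
        using False \<open>R \<subseteq> X\<close> by (auto simp: partition_on_def disjoint_def)
      have "A \<subseteq> R \<or> A \<subseteq> X - R" if "A \<in> P" for A
        using part[OF P(1)] P(2) that unfolding partition_on_def disjoint_def by blast
      then show "\<forall>A\<in>P. \<exists>B\<in>{R, X - R}. A \<subseteq> B" by simp
    qed
    then show ?thesis by auto
  qed
  show "R \<inter> S \<in> carrier (fst (B_star (X, M)))"
  proof (cases "R \<inter> S = {}")
    case False
    with R S obtain P Q where PQ: "P \<in> M" "R \<in> P" "Q \<in> M" "S \<in> Q" by auto
    have "R \<sqinter>\<^bsub>powerset_algebra X\<^esub> S = R \<inter> S"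
      using PQ part by (intro meet_powerset) (auto simp: partition_on_def)
    with PQ False have "R \<inter> S \<in> partition_meet (powerset_algebra X) P Q"
      by (force simp: partition_meet_def)
    with meet[OF PQ(1,3)] show ?thesis by auto
  qed simp
qed

end

theory Submission
  imports Defs "HOL-Analysis.Sigma_Algebra"
begin

text \<open>
  Since \<open>{b, b'} \<in> F\<close> for every nontrivial \<open>b\<close>, a proper filter that meets every \<open>p \<in> F\<close> is
  automatically an \<open>F\<close>-ultrafilter. Consequently a point of the inverse limit generates an
  \<open>F\<close>-ultrafilter, so that stability says \<open>\<iota> b \<noteq> \<emptyset>\<close> for \<open>b \<noteq> 0\<close>, and \<open>\<iota>\<close> is an order embedding which
  carries the partitions in \<open>F\<close> to a base of the uniformity. A Cauchy filter on the space of
  \<open>F\<close>-ultrafilters picks one block from every partition and thereby defines its own limit. If the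
  partitions in \<open>F\<close> are subcomplete, a block of a coarsening of \<open>\<iota>[p]\<close> is the image of the join of
  the \<open>a \<in> p\<close> with \<open>\<iota> a\<close> inside it. For a partition space, \<open>\<iota> R\<close> pulls back to \<open>R\<close> under \<open>\<C>\<close>.
\<close>

section \<open>Boolean lattices\<close>

text \<open>The record type is narrowed to \<open>'a gorder\<close>, the type on which
  \<open>complement\<close>, \<open>partitions\<close> and the notions built on them are
  declared.\<close>

locale boolean_gorder = boolean_lattice B for B :: "'a gorder" (structure)
begin

lemma bottom_join_eq: "x \<in> carrier B \<Longrightarrow> \<bottom> \<squnion> x = x"
  using bottom_join eq_is_equal by simp

lemma top_meet_eq: "x \<in> carrier B \<Longrightarrow> \<top> \<sqinter> x = x"
  using top_meet eq_is_equal by simp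

lemma le_bottom_iff: "x \<in> carrier B \<Longrightarrow> x \<sqsubseteq> \<bottom> \<longleftrightarrow> x = \<bottom>"
  by (metis bottom_closed bottom_lower le_antisym)

lemma top_le_iff: "x \<in> carrier B \<Longrightarrow> \<top> \<sqsubseteq> x \<longleftrightarrow> x = \<top>"
  by (metis top_closed top_higher le_antisym)

text \<open>Distributivity expands y = y \<sqinter> (x \<squnion> z), and the term containing x
  vanishes. This one computation yields uniqueness of complements and the link between disjointness
  and order.\<close>

lemma disjoint_codisjoint_le:
  assumes "x \<in> carrier B" "y \<in> carrier B" "z \<in> carrier B"
    and "x \<sqinter> y = \<bottom>" "x \<squnion> z = \<top>"
  shows "y \<sqsubseteq> z"
proof -
  have "y = y \<sqinter> (x \<squnion> z)"
    using assms by (metis meet_comm top_meet_eq)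
  also have "\<dots> = (y \<sqinter> x) \<squnion> (y \<sqinter> z)"
    using assms by (intro meet_join_distrib)
  also have "\<dots> = y \<sqinter> z"
    using assms by (metis meet_comm bottom_join_eq meet_closed)
  finally show ?thesis
    using assms by (metis meet_right)
qed

lemma complement_eqI:
  assumes "x \<in> carrier B" "y \<in> carrier B" "x \<sqinter> y = \<bottom>" "x \<squnion> y = \<top>"
  shows "complement B x = y"
  unfolding complement_def
proof (rule the_equality)
  fix z assume "z \<in> carrier B \<and> x \<sqinter> z = \<bottom> \<and> x \<squnion> z = \<top>"
  with assms show "z = y" by (metis disjoint_codisjoint_le le_antisym)
qed (use assms in simp)

lemma
  assumes "x \<in> carrier B"
  shows complement_closed: "complement B x \<in> carrier B"
    and meet_complement: "x \<sqinter> complement B x = \<bottom>"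
    and join_complement: "x \<squnion> complement B x = \<top>"
  using complement_exists[OF assms] complement_eqI[OF assms] by auto

lemma complement_complement: "x \<in> carrier B \<Longrightarrow> complement B (complement B x) = x"
  by (metis complement_closed complement_eqI join_comm join_complement meet_comm meet_complement)

lemma disjoint_iff_le_complement:
  assumes "x \<in> carrier B" "y \<in> carrier B"
  shows "x \<sqinter> y = \<bottom> \<longleftrightarrow> x \<sqsubseteq> complement B y"
proof
  assume "x \<sqinter> y = \<bottom>"
  with assms show "x \<sqsubseteq> complement B y"
    by (metis complement_closed disjoint_codisjoint_le join_complement meet_comm)
next
  assume le: "x \<sqsubseteq> complement B y"
  have "x \<sqinter> y \<sqsubseteq> complement B y \<sqinter> y"
    using assms le by (intro meet_le) (auto simp: complement_closed intro: le_trans meet_left meet_right)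
  with assms show "x \<sqinter> y = \<bottom>"
    by (metis le_bottom_iff meet_closed meet_comm meet_complement)
qed

lemma le_iff_disjoint_complement:
  "x \<in> carrier B \<Longrightarrow> y \<in> carrier B \<Longrightarrow> x \<sqsubseteq> y \<longleftrightarrow> x \<sqinter> complement B y = \<bottom>"
  by (simp add: complement_closed complement_complement disjoint_iff_le_complement)

section \<open>Partitions of a Boolean lattice\<close>

lemma partitions_eq:
  "partitions B = {p. p \<subseteq> carrier B - {\<bottom>} \<and> (\<forall>a\<in>p. \<forall>b\<in>p. a \<noteq> b \<longrightarrow> a \<sqinter> b = \<bottom>) \<and>
     (\<forall>c\<in>carrier B. (\<forall>a\<in>p. a \<sqsubseteq> c) \<longrightarrow> c = \<top>)}"
proof -
  \<comment> \<open>The top is always an upper bound, and it lies below another upper bound only if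
    the two are equal. So being the least one means being the only one.\<close>
  have "least B \<top> (Upper B p) \<longleftrightarrow> (\<forall>c\<in>carrier B. (\<forall>a\<in>p. a \<sqsubseteq> c) \<longrightarrow> c = \<top>)"
    if "p \<subseteq> carrier B" for p
  proof -
    have "Upper B p = {c \<in> carrier B. \<forall>a\<in>p. a \<sqsubseteq> c}"
      using that by (auto simp: Upper_def)
    moreover have "\<forall>a\<in>p. a \<sqsubseteq> \<top>"
      using that top_higher by blast
    ultimately show ?thesis
      by (auto simp: least_def top_le_iff)
  qed
  then show ?thesis
    unfolding partitions_def by (intro Collect_cong conj_cong) auto
qed

lemma partition_closed: "p \<in> partitions B \<Longrightarrow> a \<in> p \<Longrightarrow> a \<in> carrier B"
  by (auto simp: partitions_def)

lemma partition_nonbottom: "p \<in> partitions B \<Longrightarrow> a \<in> p \<Longrightarrow> a \<noteq> \<bottom>"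
  by (auto simp: partitions_def)

lemma partition_disjoint: "p \<in> partitions B \<Longrightarrow> a \<in> p \<Longrightarrow> b \<in> p \<Longrightarrow> a \<noteq> b \<Longrightarrow> a \<sqinter> b = \<bottom>"
  by (auto simp: partitions_def)

text \<open>A nonzero element below two distinct blocks would lie below their meet, which is bottom.
  This makes the description in \<open>bonding_map\<close> well defined.\<close>

lemma partition_unique_above:
  assumes "p \<in> partitions B" "a \<in> p" "b \<in> p" "c \<in> carrier B" "c \<noteq> \<bottom>" "c \<sqsubseteq> a" "c \<sqsubseteq> b"
  shows "a = b"
proof (rule ccontr)
  assume "a \<noteq> b"
  moreover have "c \<sqsubseteq> a \<sqinter> b"
    using assms partition_closed by (metis meet_le)
  ultimately show False
    using assms partition_disjoint le_bottom_iff by metis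
qed

lemma bonding_map_properties:
  assumes "p \<in> partitions B" "q \<in> partitions B" "finer B p q" "a \<in> p"
  shows "bonding_map B p q a \<in> q" "a \<sqsubseteq> bonding_map B p q a"
proof -
  obtain b where b: "b \<in> q" "a \<sqsubseteq> b"
    using assms by (auto simp: finer_def)
  then have "bonding_map B p q a = b"
    unfolding bonding_map_def
  proof (intro the_equality)
    fix c assume "c \<in> q \<and> a \<sqsubseteq> c"
    with b assms show "c = b"
      by (metis partition_closed partition_nonbottom partition_unique_above)
  qed auto
  with b show "bonding_map B p q a \<in> q" "a \<sqsubseteq> bonding_map B p q a" by auto
qed

lemma partition_meet_finer:
  assumes "p \<in> partitions B" "q \<in> partitions B"
  shows "finer B (partition_meet B p q) p" "finer B (partition_meet B p q) q"
proof -
  have "a \<sqinter> b \<sqsubseteq> a" "a \<sqinter> b \<sqsubseteq> b" if "a \<in> p" "b \<in> q" for a b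
    using that assms by (auto intro: meet_left meet_right simp: partition_closed)
  then show "finer B (partition_meet B p q) p" "finer B (partition_meet B p q) q"
    unfolding finer_def partition_meet_def by blast+
qed

end

lemma boolean_hom_inv_into:
  assumes "boolean_lattice A" "boolean_lattice B" "boolean_hom A B f"
    and bij: "bij_betw f (carrier A) (carrier B)"
  shows "boolean_hom B A (inv_into (carrier A) f)"
proof -
  interpret A: boolean_gorder A by (rule boolean_gorder.intro) fact
  interpret B: boolean_gorder B by (rule boolean_gorder.intro) fact
  let ?g = "inv_into (carrier A) f"
  have g: "?g x \<in> carrier A" "f (?g x) = x" if "x \<in> carrier B" for x
    using bij that by (auto simp: bij_betw_def inv_into_into f_inv_into_f)
  \<comment> \<open>Each identity for the inverse can now be checked after applying
    \<open>f\<close>.\<close>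
  have gI: "?g x = a" if "a \<in> carrier A" "f a = x" for a x
    using bij that by (auto simp: bij_betw_def)
  show ?thesis
    using assms(3) unfolding boolean_hom_def
    by (auto simp: g A.complement_closed intro!: gI)
qed


section \<open>Algebras of sets\<close>

text \<open>The shape of the algebras produced by \<open>B_star\<close>. For arbitrary
  \<open>C\<close> it is only a partial order; the set operations become its lattice operations once
  \<open>C\<close> is an algebra of sets.\<close>

abbreviation set_lattice :: "'a set set \<Rightarrow> 'a set gorder" where
  "set_lattice C \<equiv> \<lparr>carrier = C, eq = (=), le = (\<subseteq>)\<rparr>"

lemma partial_order_set_lattice: "partial_order (set_lattice C)"
  by unfold_locales auto

context algebra
begin

lemma least_Upper_set_lattice:
  assumes "r \<subseteq> M" "\<Union>r \<in> M"
  shows "least (set_lattice M) (\<Union>r) (Upper (set_lattice M) r)"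
  using assms by (auto simp: least_def Upper_def subset_iff)

lemma set_lattice_bottom: "\<bottom>\<^bsub>set_lattice M\<^esub> = {}"
  unfolding bottom_def least_def by (rule some_equality) auto

lemma set_lattice_top: "\<top>\<^bsub>set_lattice M\<^esub> = \<Omega>"
  unfolding top_def greatest_def by (rule some_equality) (use space_closed in auto)

lemma set_lattice_meet:
  assumes "R \<in> M" "S \<in> M"
  shows "R \<sqinter>\<^bsub>set_lattice M\<^esub> S = R \<inter> S"
proof -
  interpret L: partial_order "set_lattice M" by (rule partial_order_set_lattice)
  have "greatest (set_lattice M) (R \<inter> S) (Lower (set_lattice M) {R, S})"
    using assms by (auto simp: greatest_def Lower_def)
  \<comment> \<open>\<open>meet\<close> is a Hilbert choice among greatest lower bounds;
    antisymmetry leaves only one candidate.\<close>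
  then show ?thesis
    unfolding meet_def inf_def using L.greatest_unique by (intro some_equality)
qed

lemma set_lattice_join:
  assumes "R \<in> M" "S \<in> M"
  shows "R \<squnion>\<^bsub>set_lattice M\<^esub> S = R \<union> S"
proof -
  interpret L: partial_order "set_lattice M" by (rule partial_order_set_lattice)
  have "least (set_lattice M) (R \<union> S) (Upper (set_lattice M) {R, S})"
    using assms least_Upper_set_lattice[of "{R, S}"] by (simp add: Un)
  then show ?thesis
    unfolding join_def sup_def using L.least_unique by (intro some_equality)
qed

lemma boolean_lattice_set_lattice: "boolean_lattice (set_lattice M)"
proof -
  interpret L: partial_order "set_lattice M" by (rule partial_order_set_lattice)
  show ?thesis
  proof unfold_locales
    fix R S assume "R \<in> carrier (set_lattice M)" "S \<in> carrier (set_lattice M)"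
    then have "R \<in> M" "S \<in> M" by simp_all
    then show "\<exists>s. least (set_lattice M) s (Upper (set_lattice M) {R, S})"
      using least_Upper_set_lattice[of "{R, S}"] by (auto simp: Un)
    show "\<exists>s. greatest (set_lattice M) s (Lower (set_lattice M) {R, S})"
      using \<open>R \<in> M\<close> \<open>S \<in> M\<close>
      by (intro exI[of _ "R \<inter> S"]) (auto simp: greatest_def Lower_def)
  next
    show "\<exists>R. least (set_lattice M) R (carrier (set_lattice M))"
      by (rule exI[of _ "{}"]) (auto simp: least_def)
    show "\<exists>R. greatest (set_lattice M) R (carrier (set_lattice M))"
      using space_closed by (intro exI[of _ \<Omega>]) (auto simp: greatest_def)
  next
    fix R S T
    assume "R \<in> carrier (set_lattice M)" "S \<in> carrier (set_lattice M)" "T \<in> carrier (set_lattice M)"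
    then show "R \<sqinter>\<^bsub>set_lattice M\<^esub> (S \<squnion>\<^bsub>set_lattice M\<^esub> T) =
        (R \<sqinter>\<^bsub>set_lattice M\<^esub> S) \<squnion>\<^bsub>set_lattice M\<^esub> (R \<sqinter>\<^bsub>set_lattice M\<^esub> T)"
      by (simp add: set_lattice_meet set_lattice_join Int_Un_distrib Un Int)
  next
    fix R assume "R \<in> carrier (set_lattice M)"
    then have R: "R \<in> M" by simp
    then have "R \<inter> (\<Omega> - R) = {}" "R \<union> (\<Omega> - R) = \<Omega>" "\<Omega> - R \<in> M"
      using sets_into_space by auto
    with R show "\<exists>S\<in>carrier (set_lattice M). R \<sqinter>\<^bsub>set_lattice M\<^esub> S = \<bottom>\<^bsub>set_lattice M\<^esub> \<and>
        R \<squnion>\<^bsub>set_lattice M\<^esub> S = \<top>\<^bsub>set_lattice M\<^esub>"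
      by (intro bexI[of _ "\<Omega> - R"])
        (simp_all only: set_lattice_meet set_lattice_join set_lattice_bottom set_lattice_top
          partial_object.simps simp_thms)
  qed
qed

lemma set_lattice_complement:
  assumes "R \<in> M"
  shows "complement (set_lattice M) R = \<Omega> - R"
proof -
  interpret L: boolean_gorder "set_lattice M"
    by (rule boolean_gorder.intro[OF boolean_lattice_set_lattice])
  have "R \<inter> (\<Omega> - R) = {}" "R \<union> (\<Omega> - R) = \<Omega>" "\<Omega> - R \<in> M"
    using assms sets_into_space by auto
  with assms show ?thesis
    by (intro L.complement_eqI)
      (simp_all only: set_lattice_meet set_lattice_join set_lattice_bottom set_lattice_top
        partial_object.simps)
qed

end


section \<open>Partition spaces\<close>

text \<open>Only the meets of the blocks involved matter. Common refinements in the power set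
  algebra and in an algebra of blocks can thus be reduced to the same set of intersections.\<close>

lemma partition_meet_eqI:
  assumes "\<And>a b. a \<in> p \<Longrightarrow> b \<in> q \<Longrightarrow> a \<sqinter>\<^bsub>B\<^esub> b = g a b" "\<bottom>\<^bsub>B\<^esub> = z"
  shows "partition_meet B p q = {g a b | a b. a \<in> p \<and> b \<in> q \<and> g a b \<noteq> z}"
  unfolding partition_meet_def by (intro Collect_cong iff_exI) (use assms in auto)

lemma partition_meet_powerset:
  assumes "partition_on X P" "partition_on X Q"
  shows "partition_meet (powerset_algebra X) P Q = {R \<inter> S | R S. R \<in> P \<and> S \<in> Q \<and> R \<inter> S \<noteq> {}}"
  using assms by (intro partition_meet_eqI bottom_powerset meet_powerset) (auto simp: partition_on_def)

lemma partition_meet_partition_on: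
  assumes "partition_on X P" "partition_on X Q"
  shows "partition_on X (partition_meet (powerset_algebra X) P Q)"
  unfolding partition_meet_powerset[OF assms]
proof (rule partition_onI)
  show "\<Union>{R \<inter> S |R S. R \<in> P \<and> S \<in> Q \<and> R \<inter> S \<noteq> {}} = X"
    using assms unfolding partition_on_def by blast
  fix A B assume "A \<in> {R \<inter> S |R S. R \<in> P \<and> S \<in> Q \<and> R \<inter> S \<noteq> {}}"
    "B \<in> {R \<inter> S |R S. R \<in> P \<and> S \<in> Q \<and> R \<inter> S \<noteq> {}}" "A \<noteq> B"
  then obtain R S R' S' where "A = R \<inter> S" "B = R' \<inter> S'"
    "R \<in> P" "S \<in> Q" "R' \<in> P" "S' \<in> Q" "R \<noteq> R' \<or> S \<noteq> S'"
    by blast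
  moreover from this have "R \<inter> R' = {} \<or> S \<inter> S' = {}"
    using assms by (metis disjointD partition_onD2)
  ultimately show "disjnt A B" by (auto simp: disjnt_def)
qed auto

text \<open>Directedness replaces closure under meets: a common refinement \<open>W\<close> of
  \<open>P\<close> and \<open>Q\<close> also refines their meet, which then belongs to
  \<open>M\<close> by upward closure.\<close>

lemma partition_spaceI:
  assumes "M \<noteq> {}" and part: "\<And>P. P \<in> M \<Longrightarrow> partition_on X P"
    and up: "\<And>P Q. P \<in> M \<Longrightarrow> partition_on X Q \<Longrightarrow> (\<And>R. R \<in> P \<Longrightarrow> \<exists>S\<in>Q. R \<subseteq> S) \<Longrightarrow> Q \<in> M"
    and dir: "\<And>P Q. P \<in> M \<Longrightarrow> Q \<in> M \<Longrightarrow>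
      \<exists>W\<in>M. \<forall>T\<in>W. \<exists>R\<in>P. \<exists>S\<in>Q. T \<subseteq> R \<inter> S"
  shows "partition_space (X, M)"
proof -
  have "partition_meet (powerset_algebra X) P Q \<in> M" if PQ: "P \<in> M" "Q \<in> M" for P Q
  proof -
    obtain W where W: "W \<in> M" "\<forall>T\<in>W. \<exists>R\<in>P. \<exists>S\<in>Q. T \<subseteq> R \<inter> S"
      using dir[OF PQ] by blast
    show ?thesis
    proof (rule up[OF W(1) partition_meet_partition_on[OF part[OF PQ(1)] part[OF PQ(2)]]])
      fix T assume T: "T \<in> W"
      \<comment> \<open>A nonempty \<open>T\<close> keeps R \<inter> S nonempty, so that this
        intersection really occurs as a block of the meet.\<close>
      then have "T \<noteq> {}"
        using part[OF W(1)] by (auto simp: partition_on_def)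
      moreover obtain R S where RS: "R \<in> P" "S \<in> Q" "T \<subseteq> R \<inter> S"
        using W(2) T by blast
      ultimately have "R \<inter> S \<noteq> {}" by blast
      with RS have "R \<inter> S \<in> partition_meet (powerset_algebra X) P Q"
        unfolding partition_meet_powerset[OF part[OF PQ(1)] part[OF PQ(2)]] by blast
      with RS(3) show "\<exists>U\<in>partition_meet (powerset_algebra X) P Q. T \<subseteq> U"
        by blast
    qed
  qed
  moreover have "Q \<in> M" if "P \<in> M" "Q \<in> partitions (powerset_algebra X)"
    "finer (powerset_algebra X) P Q" for P Q
  proof (rule up[OF that(1)])
    show "partition_on X Q" using that(2) by (simp add: partitions_powerset)
    show "\<exists>S\<in>Q. R \<subseteq> S" if "R \<in> P" for R
      using that \<open>finer (powerset_algebra X) P Q\<close> by (simp add: finer_def)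
  qed
  moreover have "M \<subseteq> partitions (powerset_algebra X)"
    using part by (auto simp: partitions_powerset)
  ultimately show ?thesis
    unfolding partition_space.simps partition_filter_def using \<open>M \<noteq> {}\<close> by blast
qed

locale partition_space_locale =
  fixes X :: "'b set" and M :: "'b set set set"
  assumes partition_space: "partition_space (X, M)"
begin

lemma partition_on: "P \<in> M \<Longrightarrow> partition_on X P"
  using partition_space by (auto simp: partition_filter_def partitions_powerset)

lemma nonempty: "M \<noteq> {}"
  using partition_space by (auto simp: partition_filter_def)

lemma coarser:
  "P \<in> M \<Longrightarrow> partition_on X Q \<Longrightarrow> (\<And>R. R \<in> P \<Longrightarrow> \<exists>S\<in>Q. R \<subseteq> S) \<Longrightarrow> Q \<in> M"
  using partition_space by (auto simp: partition_filter_def finer_def partitions_powerset)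

lemma meet_mem: "P \<in> M \<Longrightarrow> Q \<in> M \<Longrightarrow> partition_meet (powerset_algebra X) P Q \<in> M"
  using partition_space by (auto simp: partition_filter_def)

section \<open>Blocks, the uniform topology and Cauchy filters\<close>

lemma block_subset: "P \<in> M \<Longrightarrow> R \<in> P \<Longrightarrow> R \<subseteq> X"
  using partition_on by (auto simp: partition_on_def)

lemma block_nonempty: "P \<in> M \<Longrightarrow> R \<in> P \<Longrightarrow> R \<noteq> {}"
  using partition_on by (auto simp: partition_on_def)

lemma block_exists: "P \<in> M \<Longrightarrow> x \<in> X \<Longrightarrow> \<exists>R\<in>P. x \<in> R"
  using partition_on by (auto simp: partition_on_def)

lemma block_unique: "P \<in> M \<Longrightarrow> R \<in> P \<Longrightarrow> S \<in> P \<Longrightarrow> x \<in> R \<Longrightarrow> x \<in> S \<Longrightarrow> R = S"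
  using disjointD[OF partition_onD2[OF partition_on[of P]], of R S] by auto

text \<open>The basic entourages are equivalence relations, so the section of one at x is the block
  containing x.\<close>

lemma openin_iff:
  "openin (uniform_topology (uniform_of (X, M))) V \<longleftrightarrow>
     V \<subseteq> X \<and> (\<forall>x\<in>V. \<exists>P\<in>M. \<forall>R\<in>P. x \<in> R \<longrightarrow> R \<subseteq> V)"
proof -
  have "(\<forall>a\<in>R. \<forall>y\<in>R. a = x \<longrightarrow> y \<in> V) \<longleftrightarrow> (x \<in> R \<longrightarrow> R \<subseteq> V)" for x R
    by auto
  moreover have "uniform_of (X, M) = (X, snd (uniform_of (X, M)))"
    by simp
  ultimately show ?thesis
    using openin_uniform_topology[of X "snd (uniform_of (X, M))" V]
    by (simp only: eventually_uniform_of[OF partition_space] prod.case)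
qed

text \<open>One partition witnesses openness at all points of its block, since no other block
  contains any of them.\<close>

lemma openin_block:
  assumes "P \<in> M" "R \<in> P"
  shows "openin (uniform_topology (uniform_of (X, M))) R"
proof -
  have "\<forall>S\<in>P. x \<in> S \<longrightarrow> S \<subseteq> R" if "x \<in> R" for x
    using block_unique[OF assms] that by auto
  then show ?thesis
    unfolding openin_iff using block_subset[OF assms] assms(1) by auto
qed

lemma topspace_eq: "topspace (uniform_topology (uniform_of (X, M))) = X"
proof
  show "topspace (uniform_topology (uniform_of (X, M))) \<subseteq> X"
    by (rule openin_topspace[THEN openin_iff[THEN iffD1], THEN conjunct1])
  have "openin (uniform_topology (uniform_of (X, M))) X"
  proof -
    obtain P where "P \<in> M" using nonempty by auto
    then show ?thesis
      unfolding openin_iff using block_subset[of P] by auto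
  qed
  then show "X \<subseteq> topspace (uniform_topology (uniform_of (X, M)))"
    by (rule openin_subset)
qed

text \<open>Blocks form a base of the topology, so density need only be tested on them.\<close>

lemma closure_eq_spaceI:
  assumes "A \<subseteq> X" "\<And>P R. P \<in> M \<Longrightarrow> R \<in> P \<Longrightarrow> A \<inter> R \<noteq> {}"
  shows "uniform_topology (uniform_of (X, M)) closure_of A = X"
proof -
  have "\<exists>y\<in>A. y \<in> V" if V: "openin (uniform_topology (uniform_of (X, M))) V" "x \<in> V" for x V
  proof -
    obtain P where P: "P \<in> M" "\<forall>R\<in>P. x \<in> R \<longrightarrow> R \<subseteq> V" "x \<in> X"
      using V(1)[unfolded openin_iff] V(2) by (metis subsetD)
    obtain R where "R \<in> P" "x \<in> R" using block_exists[OF P(1,3)] by auto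
    moreover have "A \<inter> R \<noteq> {}" by (rule assms(2)) fact+
    ultimately show ?thesis using P(2) by blast
  qed
  then show ?thesis
    unfolding closure_of_def topspace_eq by auto
qed

text \<open>Blocks containing x are open neighbourhoods of x, and every open neighbourhood of x
  contains one of them.\<close>

lemma le_nhdsin_iff:
  assumes "x \<in> X"
  shows "\<F> \<le> nhdsin (uniform_topology (uniform_of (X, M))) x \<longleftrightarrow>
    (\<forall>P\<in>M. \<forall>R\<in>P. x \<in> R \<longrightarrow> eventually (\<lambda>y. y \<in> R) \<F>)"
proof
  assume *: "\<F> \<le> nhdsin (uniform_topology (uniform_of (X, M))) x"
  show "\<forall>P\<in>M. \<forall>R\<in>P. x \<in> R \<longrightarrow> eventually (\<lambda>y. y \<in> R) \<F>"
  proof (intro ballI impI)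
    fix P R assume "P \<in> M" "R \<in> P" "x \<in> R"
    then have "eventually (\<lambda>y. y \<in> R) (nhdsin (uniform_topology (uniform_of (X, M))) x)"
      unfolding eventually_nhdsin using openin_block by auto
    with * show "eventually (\<lambda>y. y \<in> R) \<F>" by (rule filter_leD)
  qed
next
  assume *: "\<forall>P\<in>M. \<forall>R\<in>P. x \<in> R \<longrightarrow> eventually (\<lambda>y. y \<in> R) \<F>"
  show "\<F> \<le> nhdsin (uniform_topology (uniform_of (X, M))) x"
  proof (rule filter_leI)
    fix E assume "eventually E (nhdsin (uniform_topology (uniform_of (X, M))) x)"
    then obtain V where V: "openin (uniform_topology (uniform_of (X, M))) V" "x \<in> V" "\<forall>y\<in>V. E y"
      using assms unfolding eventually_nhdsin topspace_eq by auto
    then obtain P where P: "P \<in> M" "\<forall>R\<in>P. x \<in> R \<longrightarrow> R \<subseteq> V"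
      unfolding openin_iff by auto
    then obtain R where "R \<in> P" "x \<in> R" using block_exists[OF P(1) assms] by auto
    with P * have R: "eventually (\<lambda>y. y \<in> R) \<F>" "R \<subseteq> V" by auto
    show "eventually E \<F>"
      by (rule eventually_mono[OF R(1)]) (use R(2) V(3) in auto)
  qed
qed

lemma cauchy_filter_iff:
  "cauchy_filter_in (uniform_of (X, M)) \<F> \<longleftrightarrow>
     \<F> \<noteq> bot \<and> \<F> \<le> principal X \<and> (\<forall>P\<in>M. \<exists>R\<in>P. eventually (\<lambda>x. x \<in> R) \<F>)"
proof -
  have "eventually (\<lambda>z. z \<in> {(x, y). \<exists>R\<in>P. x \<in> R \<and> y \<in> R}) (\<F> \<times>\<^sub>F \<F>) \<longleftrightarrow>
      (\<exists>R\<in>P. eventually (\<lambda>x. x \<in> R) \<F>)" (is "?L \<longleftrightarrow> ?R") if P: "P \<in> M" and "\<F> \<noteq> bot" for P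
  proof
    assume ?L
    then obtain E G where E: "eventually E \<F>" "eventually G \<F>"
      and EG: "\<And>x y. E x \<Longrightarrow> G y \<Longrightarrow> \<exists>R\<in>P. x \<in> R \<and> y \<in> R"
      unfolding eventually_prod_filter by auto
    \<comment> \<open>The rectangle with sides \<open>E\<close> and \<open>G\<close> lies in the
      union of the squares of the blocks. Fixing one x in \<open>E\<close> forces all of
      \<open>G\<close> into the block of x; the points x and y exist because the filter is not
      \<open>bot\<close>.\<close>
    obtain x where x: "E x"
      using E(1) \<open>\<F> \<noteq> bot\<close> eventually_happens' by blast
    obtain y where "G y"
      using E(2) \<open>\<F> \<noteq> bot\<close> eventually_happens' by blast
    with x EG obtain R where R: "R \<in> P" "x \<in> R" by blast
    have "z \<in> R" if "G z" for z
      using EG[OF x that] block_unique[OF P R(1) _ R(2)] by auto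
    then have "eventually (\<lambda>z. z \<in> R) \<F>"
      by (rule eventually_mono[OF E(2)])
    with R(1) show ?R by (rule bexI[rotated])
  next
    assume ?R
    then show ?L unfolding eventually_prod_filter by blast
  qed
  then show ?thesis
    by (auto simp: le_INF_iff le_principal)
qed

text \<open>The uniformity is already concentrated on the square of \<open>X\<close>. Hence an
  embedding whose image is the whole space is a homeomorphism.\<close>

lemma uniform_subspace_space: "uniform_subspace (uniform_of (X, M)) X = uniform_of (X, M)"
proof -
  have "snd (uniform_of (X, M)) \<le> principal (X \<times> X)"
    unfolding le_principal eventually_uniform_of[OF partition_space]
  proof -
    obtain P where P: "P \<in> M" using nonempty by auto
    show "\<exists>P\<in>M. \<forall>R\<in>P. \<forall>x\<in>R. \<forall>y\<in>R. (x, y) \<in> X \<times> X"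
      by (rule bexI[OF _ P]) (use block_subset[OF P] in auto)
  qed
  then show ?thesis
    by (simp add: inf_absorb1)
qed

section \<open>The algebra of blocks\<close>

lemma binary_partition_mem:
  assumes "P \<in> M" "R \<subseteq> X" "\<And>S. S \<in> P \<Longrightarrow> S \<subseteq> R \<or> S \<subseteq> X - R"
  shows "{R, X - R} - {{}} \<in> M"
proof (rule coarser[OF assms(1)])
  \<comment> \<open>Removing the empty set covers the degenerate cases in which \<open>R\<close> is
    empty or all of \<open>X\<close>.\<close>
  show "partition_on X ({R, X - R} - {{}})"
    using assms(2) by (auto simp: partition_on_def disjoint_def)
  fix S assume "S \<in> P"
  then show "\<exists>T\<in>{R, X - R} - {{}}. S \<subseteq> T"
    using assms(3)[of S] block_nonempty[OF assms(1), of S] by auto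
qed

text \<open>A partition with block \<open>R\<close> can be coarsened by merging all other blocks, so
  membership depends on a partition into at most two sets determined by \<open>R\<close>.\<close>

lemma mem_blocks_iff:
  "R \<in> {{}} \<union> \<Union>M \<longleftrightarrow> R \<subseteq> X \<and> {R, X - R} - {{}} \<in> M" (is "?L \<longleftrightarrow> ?R")
proof
  assume ?L
  \<comment> \<open>For empty \<open>R\<close> any partition in \<open>M\<close> will do, as every
    block then lies in the complement.\<close>
  obtain P where P: "P \<in> M" "R \<noteq> {} \<longrightarrow> R \<in> P"
    using \<open>?L\<close> nonempty by auto
  have "R \<subseteq> X"
    using P block_subset[of P R] by auto
  moreover have "{R, X - R} - {{}} \<in> M"
  proof (rule binary_partition_mem[OF P(1)])
    fix S assume S: "S \<in> P"
    show "S \<subseteq> R \<or> S \<subseteq> X - R"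
      using block_unique[OF P(1) S, of R] P(2) block_subset[OF P(1) S] by auto
  qed fact
  ultimately show ?R by blast
qed auto

text \<open>Each block of \<open>P\<close> is a member of \<open>r\<close> or disjoint from its
  union, so splitting \<open>X\<close> along that union coarsens \<open>P\<close>. This is the
  source of subcompleteness.\<close>

lemma Union_blocks:
  assumes "P \<in> M" "r \<subseteq> P"
  shows "\<Union>r \<in> {{}} \<union> \<Union>M"
  unfolding mem_blocks_iff
proof
  show sub: "\<Union>r \<subseteq> X"
    using assms block_subset[OF assms(1)] by auto
  show "{\<Union>r, X - \<Union>r} - {{}} \<in> M"
  proof (rule binary_partition_mem[OF assms(1) sub])
    fix S assume S: "S \<in> P"
    show "S \<subseteq> \<Union>r \<or> S \<subseteq> X - \<Union>r"
    proof (cases "S \<in> r")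
      case False
      then have "S \<inter> T = {}" if "T \<in> r" for T
        using block_unique[OF assms(1) S, of T] that assms(2) by auto
      then show ?thesis
        using block_subset[OF assms(1) S] by auto
    qed auto
  qed
qed

lemma algebra_blocks: "algebra X ({{}} \<union> \<Union>M)"
  unfolding algebra_iff_Int
  using B_star_subalgebra[OF partition_space] block_subset by auto

sublocale blocks: algebra X "{{}} \<union> \<Union>M"
  by (rule algebra_blocks)

text \<open>A join in the algebra of blocks need not be a union, so a partition \<open>Q\<close> of
  that algebra need not cover \<open>X\<close>. Here covering is inherited from the finer partition
  \<open>P\<close>.\<close>

lemma coarser_blocks:
  assumes "P \<in> M" and Q: "Q \<in> partitions (set_lattice ({{}} \<union> \<Union>M))"
    and "\<And>R. R \<in> P \<Longrightarrow> \<exists>S\<in>Q. R \<subseteq> S"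
  shows "Q \<in> M"
proof -
  interpret L: boolean_gorder "set_lattice ({{}} \<union> \<Union>M)"
    by (rule boolean_gorder.intro[OF blocks.boolean_lattice_set_lattice])
  have c: "R \<in> {{}} \<union> \<Union>M" if "R \<in> Q" for R
    using L.partition_closed[OF Q that] by simp
  show "Q \<in> M"
  proof (rule coarser[OF assms(1)])
    show "partition_on X Q"
    proof (rule partition_onI)
      show "\<Union>Q = X"
      proof
        show "\<Union>Q \<subseteq> X"
          using c blocks.sets_into_space by auto
        show "X \<subseteq> \<Union>Q"
        proof
          fix x assume "x \<in> X"
          then obtain R where R: "R \<in> P" "x \<in> R"
            using block_exists[OF assms(1)] by auto
          show "x \<in> \<Union>Q"
            using assms(3)[OF R(1)] R(2) by auto
        qed
      qed
      fix R S assume RS: "R \<in> Q" "S \<in> Q" "R \<noteq> S"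
      have "R \<sqinter>\<^bsub>set_lattice ({{}} \<union> \<Union>M)\<^esub> S = R \<inter> S"
        using RS c by (intro blocks.set_lattice_meet) auto
      then show "disjnt R S"
        using L.partition_disjoint[OF Q RS] blocks.set_lattice_bottom by (auto simp: disjnt_def)
    next
      show "{} \<notin> Q"
        using L.partition_nonbottom[OF Q] blocks.set_lattice_bottom by auto
    qed
  qed (rule assms(3))
qed

lemma mem_partitions_blocks:
  assumes "P \<in> M"
  shows "P \<in> partitions (set_lattice ({{}} \<union> \<Union>M))"
proof -
  have "R \<sqinter>\<^bsub>set_lattice ({{}} \<union> \<Union>M)\<^esub> S = {}" if "R \<in> P" "S \<in> P" "R \<noteq> S" for R S
  proof -
    have "R \<sqinter>\<^bsub>set_lattice ({{}} \<union> \<Union>M)\<^esub> S = R \<inter> S"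
      using that assms by (intro blocks.set_lattice_meet) auto
    then show ?thesis
      using that block_unique[OF assms] by auto
  qed
  moreover have "\<Union>P = X"
    using partition_on[OF assms] by (auto simp: partition_on_def)
  then have "least (set_lattice ({{}} \<union> \<Union>M)) X (Upper (set_lattice ({{}} \<union> \<Union>M)) P)"
    using blocks.least_Upper_set_lattice[of P] blocks.top assms by (auto simp del: Union_iff)
  ultimately show ?thesis
    using assms block_nonempty[OF assms]
    unfolding partitions_def blocks.set_lattice_bottom blocks.set_lattice_top by auto
qed

lemma partition_meet_blocks:
  assumes "P \<in> M" "Q \<in> M"
  shows "partition_meet (set_lattice ({{}} \<union> \<Union>M)) P Q = partition_meet (powerset_algebra X) P Q"
  unfolding partition_meet_powerset[OF partition_on[OF assms(1)] partition_on[OF assms(2)]]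
  using assms by (intro partition_meet_eqI blocks.set_lattice_bottom blocks.set_lattice_meet) auto

section \<open>The Boolean partition algebra of a partition space\<close>

lemma boolean_partition_algebra_B_star: "boolean_partition_algebra (B_star (X, M))"
proof -
  have "partition_filter (set_lattice ({{}} \<union> \<Union>M)) M"
    unfolding partition_filter_def
  proof (intro conjI ballI impI)
    show "M \<subseteq> partitions (set_lattice ({{}} \<union> \<Union>M))"
      using mem_partitions_blocks by (rule subsetI)
    show "partition_meet (set_lattice ({{}} \<union> \<Union>M)) P Q \<in> M" if "P \<in> M" "Q \<in> M" for P Q
      using that by (simp only: partition_meet_blocks meet_mem)
    show "Q \<in> M" if "P \<in> M" "Q \<in> partitions (set_lattice ({{}} \<union> \<Union>M))"
      "finer (set_lattice ({{}} \<union> \<Union>M)) P Q" for P Q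
      using that(3) by (intro coarser_blocks[OF that(1,2)]) (simp add: finer_def)
  qed (rule nonempty)
  moreover have "{R, complement (set_lattice ({{}} \<union> \<Union>M)) R} \<in> M"
    if R: "R \<in> {{}} \<union> \<Union>M" "R \<noteq> {}" "R \<noteq> X" for R
  proof -
    have "X - R \<noteq> {}" using R mem_blocks_iff[of R] by auto
    with R have "{R, X - R} - {{}} = {R, X - R}" by auto
    with R mem_blocks_iff[of R] show ?thesis
      unfolding blocks.set_lattice_complement[OF R(1)] by simp
  qed
  ultimately show ?thesis
    using blocks.boolean_lattice_set_lattice
    unfolding B_star.simps boolean_partition_algebra.simps blocks.set_lattice_bottom
      blocks.set_lattice_top by auto
qed

lemma subcomplete_B_star: "subcomplete (B_star (X, M))"
  unfolding B_star.simps subcomplete.simps subcomplete_partition_def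
proof (intro ballI allI impI)
  fix P r assume "P \<in> M" "r \<subseteq> P"
  then show "\<exists>s. least (set_lattice ({{}} \<union> \<Union>M)) s (Upper (set_lattice ({{}} \<union> \<Union>M)) r)"
    by (intro exI[of _ "\<Union>r"] blocks.least_Upper_set_lattice Union_blocks) auto
qed

text \<open>A point x of \<open>R\<close> selects the block containing it in every partition. These
  blocks are compatible, because a larger block above one containing x contains x as well.\<close>

lemma stable_B_star: "stable (B_star (X, M))"
  unfolding B_star.simps stable.simps blocks.set_lattice_bottom
proof
  fix R assume "R \<in> carrier (set_lattice ({{}} \<union> \<Union>M)) - {{}}"
  then obtain P where P: "P \<in> M" "R \<in> P" and "R \<noteq> {}" by auto
  then obtain x where x: "x \<in> R" by blast
  with P have "x \<in> X" using block_subset[OF P] by auto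
  \<comment> \<open>The function is restricted to \<open>M\<close> because
    \<open>inverse_limit\<close> consists of extensional families.\<close>
  define y where "y = (\<lambda>Q\<in>M. THE S. S \<in> Q \<and> x \<in> S)"
  have y: "y Q = S" if "Q \<in> M" "S \<in> Q" "x \<in> S" for Q S
    using that block_unique[OF that(1)] by (auto simp: y_def intro!: the_equality)
  have y': "y Q \<in> Q" "x \<in> y Q" if "Q \<in> M" for Q
    using y[OF that] block_exists[OF that \<open>x \<in> X\<close>] by auto
  have "bonding_map (set_lattice ({{}} \<union> \<Union>M)) Q S (y Q) = y S"
    if QS: "Q \<in> M" "S \<in> M" "finer (set_lattice ({{}} \<union> \<Union>M)) Q S" for Q S
  proof -
    interpret L: boolean_gorder "set_lattice ({{}} \<union> \<Union>M)"
      by (rule boolean_gorder.intro[OF blocks.boolean_lattice_set_lattice])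
    show ?thesis
      using y[OF QS(2)] y'[OF QS(1)] L.bonding_map_properties[OF _ _ QS(3), of "y Q"] QS
        mem_partitions_blocks by auto
  qed
  moreover have "y \<in> (\<Pi>\<^sub>E Q\<in>M. Q)"
    using y' by (auto simp: y_def)
  ultimately show "\<exists>y\<in>inverse_limit (set_lattice ({{}} \<union> \<Union>M), M). \<exists>P\<in>M. y P = R"
    using y[OF P x] P(1) by auto
qed

end

section \<open>Boolean partition algebras\<close>

declare F_ultrafilters.simps [simp del] S_star.simps [simp del]

locale boolean_partition_algebra_locale =
  fixes B :: "'a gorder" (structure) and F :: "'a set set"
  assumes boolean_partition_algebra: "boolean_partition_algebra (B, F)"

sublocale boolean_partition_algebra_locale \<subseteq> boolean_gorder B
  using boolean_partition_algebra by (intro boolean_gorder.intro) simp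

context boolean_partition_algebra_locale
begin

section \<open>\<open>F\<close>-ultrafilters\<close>

abbreviation S :: "'a set set" where "S \<equiv> F_ultrafilters (B, F)"

abbreviation \<iota> :: "'a \<Rightarrow> 'a set set" where "\<iota> \<equiv> iota (B, F)"

lemma mem_partitions: "p \<in> F \<Longrightarrow> p \<in> partitions B"
  using boolean_partition_algebra by (auto simp: partition_filter_def)

lemma partition_meet_mem: "p \<in> F \<Longrightarrow> q \<in> F \<Longrightarrow> partition_meet B p q \<in> F"
  using boolean_partition_algebra by (auto simp: partition_filter_def)

lemma coarser_mem: "p \<in> F \<Longrightarrow> q \<in> partitions B \<Longrightarrow> finer B p q \<Longrightarrow> q \<in> F"
  using boolean_partition_algebra by (auto simp: partition_filter_def)

lemma filter_nonempty: "F \<noteq> {}"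
  using boolean_partition_algebra by (auto simp: partition_filter_def)

lemma binary_mem: "b \<in> carrier B \<Longrightarrow> b \<noteq> \<bottom> \<Longrightarrow> b \<noteq> \<top> \<Longrightarrow> {b, complement B b} \<in> F"
  using boolean_partition_algebra by auto

lemma mem_F_ultrafilters_iff:
  "U \<in> S \<longleftrightarrow> proper_filter B U \<and> (\<forall>p\<in>F. \<exists>a\<in>p. a \<in> U)"
proof
  assume U: "U \<in> S"
  have "\<exists>a\<in>p. a \<in> U" if "p \<in> F" for p
  proof -
    have "U \<inter> p \<noteq> {}" using U that by (force simp: F_ultrafilters.simps)
    then show ?thesis by auto
  qed
  with U show "proper_filter B U \<and> (\<forall>p\<in>F. \<exists>a\<in>p. a \<in> U)"
    by (simp add: F_ultrafilters.simps ultrafilter_def)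
next
  assume U: "proper_filter B U \<and> (\<forall>p\<in>F. \<exists>a\<in>p. a \<in> U)"
  then have sub: "U \<subseteq> carrier B" and "U \<noteq> {}" and "\<bottom> \<notin> U"
    and meet: "\<And>a b. a \<in> U \<Longrightarrow> b \<in> U \<Longrightarrow> a \<sqinter> b \<in> U"
    and up: "\<And>a b. a \<in> U \<Longrightarrow> b \<in> carrier B \<Longrightarrow> a \<sqsubseteq> b \<Longrightarrow> b \<in> U"
    by (auto simp: proper_filter_def)
  have "card (U \<inter> p) = 1" if p: "p \<in> F" for p
  proof -
    obtain a where a: "a \<in> p" "a \<in> U" using U p by auto
    \<comment> \<open>Two distinct blocks in \<open>U\<close> would put their meet, bottom, into
      \<open>U\<close>.\<close>
    moreover have "b = a" if "b \<in> U \<inter> p" for b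
    proof (rule ccontr)
      assume "b \<noteq> a"
      with a that have "b \<sqinter> a = \<bottom>"
        using partition_disjoint[OF mem_partitions[OF p]] by simp
      with meet[of b a] a(2) that \<open>\<bottom> \<notin> U\<close> show False by simp
    qed
    ultimately have "is_singleton (U \<inter> p)"
      by (intro is_singletonI') auto
    then have "card (U \<inter> p) = 1"
      by (simp add: is_singleton_altdef)
    then show ?thesis by simp
  qed
  moreover have "V = U" if V: "proper_filter B V" "U \<subseteq> V" for V
  proof
    show "V \<subseteq> U"
    proof
      fix v assume "v \<in> V"
      with V have v: "v \<in> carrier B" "v \<noteq> \<bottom>" by (auto simp: proper_filter_def)
      show "v \<in> U"
      \<comment> \<open>A partition consisting of v and its complement is available only for
        nontrivial v, while the top lies in every filter. In the nontrivial case \<open>U\<close>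
        contains one of the two, and the proper filter \<open>V\<close> excludes the
        complement.\<close>
      proof (cases "v = \<top>")
        case True
        obtain u where "u \<in> U" using \<open>U \<noteq> {}\<close> by auto
        then show ?thesis using True up[of u \<top>] sub by auto
      next
        case False
        have "v \<in> U \<or> complement B v \<in> U"
          using U binary_mem[OF v False] by auto
        moreover have "complement B v \<notin> U"
        proof
          assume "complement B v \<in> U"
          with V \<open>v \<in> V\<close> have "v \<sqinter> complement B v \<in> V"
            by (auto simp: proper_filter_def)
          with V(1) v(1) show False
            by (simp add: meet_complement proper_filter_def)
        qed
        ultimately show ?thesis by simp
      qed
    qed
  qed (rule V(2))
  ultimately show "U \<in> S"
    using U by (simp add: F_ultrafilters.simps ultrafilter_def)
qed

lemma F_ultrafilter_subset: "U \<in> S \<Longrightarrow> a \<in> U \<Longrightarrow> a \<in> carrier B"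
  by (auto simp: mem_F_ultrafilters_iff proper_filter_def)

lemma F_ultrafilter_bottom: "U \<in> S \<Longrightarrow> \<bottom> \<notin> U"
  by (auto simp: mem_F_ultrafilters_iff proper_filter_def)

lemma F_ultrafilter_up: "U \<in> S \<Longrightarrow> a \<in> U \<Longrightarrow> b \<in> carrier B \<Longrightarrow> a \<sqsubseteq> b \<Longrightarrow> b \<in> U"
  by (auto simp: mem_F_ultrafilters_iff proper_filter_def)

lemma F_ultrafilter_top:
  assumes "U \<in> S"
  shows "\<top> \<in> U"
proof -
  have "U \<noteq> {}" using assms by (simp add: mem_F_ultrafilters_iff proper_filter_def)
  then obtain u where "u \<in> U" by auto
  then show ?thesis
    using F_ultrafilter_up[OF assms, of u \<top>] F_ultrafilter_subset[OF assms] by auto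
qed

lemma F_ultrafilter_meet_iff:
  assumes "U \<in> S" "a \<in> carrier B" "b \<in> carrier B"
  shows "a \<sqinter> b \<in> U \<longleftrightarrow> a \<in> U \<and> b \<in> U"
proof
  assume "a \<sqinter> b \<in> U"
  then show "a \<in> U \<and> b \<in> U"
    using assms F_ultrafilter_up[OF assms(1), of "a \<sqinter> b"] by (auto intro: meet_left meet_right)
next
  assume "a \<in> U \<and> b \<in> U"
  then show "a \<sqinter> b \<in> U"
    using assms(1) by (simp add: mem_F_ultrafilters_iff proper_filter_def)
qed

lemma F_ultrafilter_block: "U \<in> S \<Longrightarrow> p \<in> F \<Longrightarrow> \<exists>a\<in>p. a \<in> U"
  by (simp add: mem_F_ultrafilters_iff)

lemma F_ultrafilter_complement_iff:
  assumes U: "U \<in> S" and b: "b \<in> carrier B"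
  shows "complement B b \<in> U \<longleftrightarrow> b \<notin> U"
proof -
  have "\<not> (b \<in> U \<and> complement B b \<in> U)"
    using F_ultrafilter_meet_iff[OF U b complement_closed[OF b]] F_ultrafilter_bottom[OF U]
    by (simp add: meet_complement b)
  moreover have "b \<in> U \<or> complement B b \<in> U"
  proof (cases "b = \<bottom>")
    case True
    then have "complement B b = \<top>"
      using bottom_join_eq[OF complement_closed[OF b]] join_complement[OF b] by simp
    then show ?thesis using F_ultrafilter_top[OF U] by simp
  next
    case False
    then show ?thesis
      using F_ultrafilter_top[OF U] F_ultrafilter_block[OF U binary_mem[OF b]]
      by (cases "b = \<top>") auto
  qed
  ultimately show ?thesis by blast
qed

lemma F_ultrafilter_join_iff:
  assumes U: "U \<in> S" and ab: "a \<in> carrier B" "b \<in> carrier B"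
  shows "a \<squnion> b \<in> U \<longleftrightarrow> a \<in> U \<or> b \<in> U"
proof
  assume *: "a \<squnion> b \<in> U"
  show "a \<in> U \<or> b \<in> U"
  proof (rule disjCI)
    assume "b \<notin> U"
    \<comment> \<open>With b outside \<open>U\<close> its complement is inside, and meeting with it
      cuts the join down to a part of a.\<close>
    then have "complement B b \<sqinter> (a \<squnion> b) \<in> U"
      using * ab by (simp add: F_ultrafilter_meet_iff[OF U] F_ultrafilter_complement_iff[OF U] complement_closed)
    moreover have "complement B b \<sqinter> (a \<squnion> b) = complement B b \<sqinter> a"
      using ab meet_join_distrib[of "complement B b" a b] meet_complement[OF ab(2)]
        bottom_join_eq[of "complement B b \<sqinter> a"]
      by (simp add: complement_closed meet_comm[of B "complement B b" b] join_comm[of B _ "\<bottom>"])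
    ultimately show "a \<in> U"
      using F_ultrafilter_meet_iff[OF U complement_closed[OF ab(2)] ab(1)] by simp
  qed
next
  assume "a \<in> U \<or> b \<in> U"
  then show "a \<squnion> b \<in> U"
    using ab F_ultrafilter_up[OF U, of a "a \<squnion> b"] F_ultrafilter_up[OF U, of b "a \<squnion> b"]
    by (auto intro: join_left join_right)
qed

text \<open>An element of \<open>V\<close> missing from \<open>U\<close> would have its complement
  in \<open>U\<close>, hence in \<open>V\<close>.\<close>

lemma F_ultrafilters_eqI:
  assumes "U \<in> S" "V \<in> S" "U \<subseteq> V"
  shows "U = V"
proof
  show "V \<subseteq> U"
    using assms F_ultrafilter_complement_iff F_ultrafilter_subset by (meson subsetD subsetI)
qed (rule assms(3))

section \<open>The map \<open>\<iota>\<close> and the points of the inverse limit\<close>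

lemma iota_bottom: "\<iota> \<bottom> = {}"
  using F_ultrafilter_bottom by (auto simp: iota_def)

lemma iota_top: "\<iota> \<top> = S"
  using F_ultrafilter_top by (auto simp: iota_def)

lemma iota_meet: "a \<in> carrier B \<Longrightarrow> b \<in> carrier B \<Longrightarrow> \<iota> (a \<sqinter> b) = \<iota> a \<inter> \<iota> b"
  using F_ultrafilter_meet_iff by (auto simp: iota_def)

lemma iota_join: "a \<in> carrier B \<Longrightarrow> b \<in> carrier B \<Longrightarrow> \<iota> (a \<squnion> b) = \<iota> a \<union> \<iota> b"
  using F_ultrafilter_join_iff by (auto simp: iota_def)

lemma iota_complement: "a \<in> carrier B \<Longrightarrow> \<iota> (complement B a) = S - \<iota> a"
  using F_ultrafilter_complement_iff by (auto simp: iota_def)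

lemma iota_subset: "\<iota> a \<subseteq> S"
  by (auto simp: iota_def)

lemma iota_mono: "a \<sqsubseteq> b \<Longrightarrow> b \<in> carrier B \<Longrightarrow> \<iota> a \<subseteq> \<iota> b"
  using F_ultrafilter_up by (auto simp: iota_def)

lemma iota_disjoint:
  assumes "p \<in> F" "a \<in> p" "b \<in> p" "a \<noteq> b"
  shows "\<iota> a \<inter> \<iota> b = {}"
  using assms iota_meet[of a b] partition_disjoint[of p a b] partition_closed[of p] mem_partitions
  by (simp add: iota_bottom)

lemma Union_iota: "p \<in> F \<Longrightarrow> (\<Union>a\<in>p. \<iota> a) = S"
  using F_ultrafilter_block by (auto simp: iota_def)

text \<open>The values of x form a filter base: at the common refinement of p and q, compatibility
  puts the value below both \<open>x p\<close> and \<open>x q\<close>. Since \<open>x p\<close>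
  itself belongs to the generated filter, every p in \<open>F\<close> is met.\<close>

lemma limit_F_ultrafilter:
  assumes x: "x \<in> inverse_limit (B, F)"
  shows "{a \<in> carrier B. \<exists>p\<in>F. x p \<sqsubseteq> a} \<in> S"
proof -
  let ?U = "{a \<in> carrier B. \<exists>p\<in>F. x p \<sqsubseteq> a}"
  have xp: "x p \<in> p" if "p \<in> F" for p
    using x that by auto
  have c: "x p \<in> carrier B" "x p \<noteq> \<bottom>" if "p \<in> F" for p
    using partition_closed[OF mem_partitions[OF that] xp[OF that]]
      partition_nonbottom[OF mem_partitions[OF that] xp[OF that]] by auto
  have le: "x r \<sqsubseteq> x p" if "r \<in> F" "p \<in> F" "finer B r p" for r p
  proof -
    have "bonding_map B r p (x r) = x p"
      using x that by simp
    then show ?thesis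
      using bonding_map_properties(2)[OF mem_partitions[OF that(1)] mem_partitions[OF that(2)] that(3)
          xp[OF that(1)]] by simp
  qed
  have "a \<sqinter> b \<in> ?U" if U: "a \<in> ?U" "b \<in> ?U" for a b
  proof -
    have ab: "a \<in> carrier B" "b \<in> carrier B" using U by auto
    obtain p where p: "p \<in> F" "x p \<sqsubseteq> a" using U by auto
    obtain q where q: "q \<in> F" "x q \<sqsubseteq> b" using U by auto
    let ?r = "partition_meet B p q"
    have r: "?r \<in> F" using p q by (simp add: partition_meet_mem)
    have "x ?r \<sqsubseteq> x p" "x ?r \<sqsubseteq> x q"
      using le[OF r p(1)] le[OF r q(1)] p q partition_meet_finer mem_partitions by auto
    then have "x ?r \<sqsubseteq> a" "x ?r \<sqsubseteq> b"
      using le_trans[of "x ?r" "x p" a] le_trans[of "x ?r" "x q" b] p q c r ab by auto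
    then have "x ?r \<sqsubseteq> a \<sqinter> b"
      using c[OF r] ab by (intro meet_le)
    with r ab show ?thesis by auto
  qed
  moreover have "b \<in> ?U" if b: "a \<in> ?U" "b \<in> carrier B" "a \<sqsubseteq> b" for a b
  proof -
    obtain p where "p \<in> F" "x p \<sqsubseteq> a" "a \<in> carrier B" using b by auto
    with b le_trans[of "x p" a b] c[of p] show ?thesis by auto
  qed
  moreover have "\<exists>a\<in>p. a \<in> ?U" if "p \<in> F" for p
    using xp[OF that] c[OF that] that by auto
  moreover from this have "?U \<noteq> {}"
    using filter_nonempty by fast
  moreover have "\<bottom> \<notin> ?U"
    using c le_bottom_iff by auto
  ultimately show ?thesis
    unfolding mem_F_ultrafilters_iff proper_filter_def by blast
qed

end

section \<open>Stable algebras and the space of \<open>F\<close>-ultrafilters\<close>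

locale stable_boolean_partition_algebra = boolean_partition_algebra_locale +
  assumes stable: "stable (B, F)"
begin

text \<open>Stability enters the later arguments here: a compatible family passing through b
  generates an \<open>F\<close>-ultrafilter containing b.\<close>

lemma iota_nonempty:
  assumes "b \<in> carrier B" "b \<noteq> \<bottom>"
  shows "\<iota> b \<noteq> {}"
proof -
  have "b \<in> carrier B - {\<bottom>}" using assms by simp
  with stable obtain x p where x: "x \<in> inverse_limit (B, F)" and p: "p \<in> F" "x p = b"
    unfolding stable.simps by (metis (lifting))
  have "{a \<in> carrier B. \<exists>p\<in>F. x p \<sqsubseteq> a} \<in> \<iota> b"
    using limit_F_ultrafilter[OF x] p assms by (auto simp: iota_def)
  then show ?thesis by auto
qed

text \<open>If a is not below b, the part of a outside b is nonzero and belongs to some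
  \<open>F\<close>-ultrafilter, which contains a but not b.\<close>

lemma iota_subset_iff:
  assumes "a \<in> carrier B" "b \<in> carrier B"
  shows "\<iota> a \<subseteq> \<iota> b \<longleftrightarrow> a \<sqsubseteq> b"
proof
  assume "\<iota> a \<subseteq> \<iota> b"
  then have "\<iota> (a \<sqinter> complement B b) = {}"
    using assms by (auto simp: iota_meet complement_closed iota_complement)
  then show "a \<sqsubseteq> b"
    using assms iota_nonempty[of "a \<sqinter> complement B b"]
    by (auto simp: le_iff_disjoint_complement complement_closed)
qed (use assms iota_mono in simp)

lemma inj_on_iota: "inj_on \<iota> (carrier B)"
proof (rule inj_onI)
  fix a b assume "a \<in> carrier B" "b \<in> carrier B" "\<iota> a = \<iota> b"
  then show "a = b"
    using iota_subset_iff[of a b] iota_subset_iff[of b a] by auto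
qed

lemma iota_partition_on:
  assumes "p \<in> F"
  shows "partition_on S (\<iota> ` p)"
proof (rule partition_onI)
  show "\<Union>(\<iota> ` p) = S"
    by (rule Union_iota[OF assms])
  show "{} \<notin> \<iota> ` p"
    using iota_nonempty partition_closed[OF mem_partitions[OF assms]]
      partition_nonbottom[OF mem_partitions[OF assms]] by force
  fix R T assume "R \<in> \<iota> ` p" "T \<in> \<iota> ` p" "R \<noteq> T"
  then show "disjnt R T"
    using iota_disjoint[OF assms] by (auto simp: disjnt_def)
qed

abbreviation N :: "'a set set set set" where "N \<equiv> snd (S_star (B, F))"

lemma mem_S_star_iff:
  "Z \<in> N \<longleftrightarrow> partition_on S Z \<and> (\<exists>p\<in>F. \<forall>a\<in>p. \<exists>R\<in>Z. \<iota> a \<subseteq> R)"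
  by (simp add: S_star.simps partitions_powerset finer_def)

lemma iota_partition_mem: "p \<in> F \<Longrightarrow> \<iota> ` p \<in> N"
  unfolding mem_S_star_iff using iota_partition_on by auto

lemma S_star_eq: "S_star (B, F) = (S, N)"
  by (simp add: S_star.simps)

text \<open>For directedness, the image under \<open>\<iota>\<close> of the common refinement in
  \<open>F\<close> is a common refinement, as \<open>\<iota>\<close> turns meets into
  intersections.\<close>

lemma partition_space_S_star: "partition_space (S, N)"
proof (rule partition_spaceI)
  show "N \<noteq> {}"
    using filter_nonempty iota_partition_mem by fast
  show "partition_on S Z" if "Z \<in> N" for Z
    using that unfolding mem_S_star_iff by simp
  show "Z' \<in> N" if "Z \<in> N" "partition_on S Z'" "\<And>R. R \<in> Z \<Longrightarrow> \<exists>R'\<in>Z'. R \<subseteq> R'" for Z Z'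
  proof -
    obtain p where p: "p \<in> F" "\<forall>a\<in>p. \<exists>R\<in>Z. \<iota> a \<subseteq> R"
      using \<open>Z \<in> N\<close> unfolding mem_S_star_iff by auto
    have "\<exists>R'\<in>Z'. \<iota> a \<subseteq> R'" if "a \<in> p" for a
      using p(2) that \<open>\<And>R. R \<in> Z \<Longrightarrow> \<exists>R'\<in>Z'. R \<subseteq> R'\<close> by (meson subset_trans)
    with p(1) that(2) show ?thesis unfolding mem_S_star_iff by auto
  qed
  show "\<exists>W\<in>N. \<forall>T\<in>W. \<exists>R\<in>Z. \<exists>R'\<in>Z'. T \<subseteq> R \<inter> R'" if Z: "Z \<in> N" "Z' \<in> N" for Z Z'
  proof -
    obtain p where p: "p \<in> F" "\<And>a. a \<in> p \<Longrightarrow> \<exists>R\<in>Z. \<iota> a \<subseteq> R"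
      using Z(1) unfolding mem_S_star_iff by auto
    obtain q where q: "q \<in> F" "\<And>a. a \<in> q \<Longrightarrow> \<exists>R\<in>Z'. \<iota> a \<subseteq> R"
      using Z(2) unfolding mem_S_star_iff by auto
    have "\<exists>R\<in>Z. \<exists>R'\<in>Z'. T \<subseteq> R \<inter> R'" if "T \<in> \<iota> ` partition_meet B p q" for T
    proof -
      obtain a b where ab: "a \<in> p" "b \<in> q" "T = \<iota> (a \<sqinter> b)"
        using \<open>T \<in> \<iota> ` partition_meet B p q\<close> unfolding partition_meet_def by auto
      then have T: "T = \<iota> a \<inter> \<iota> b"
        using partition_closed[OF mem_partitions[OF p(1)]] partition_closed[OF mem_partitions[OF q(1)]]
        by (simp add: iota_meet)
      obtain R where "R \<in> Z" "\<iota> a \<subseteq> R" using p(2)[OF ab(1)] by auto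
      moreover obtain R' where "R' \<in> Z'" "\<iota> b \<subseteq> R'" using q(2)[OF ab(2)] by auto
      ultimately show ?thesis using T by (meson Int_mono order_refl)
    qed
    then show ?thesis
      using iota_partition_mem[OF partition_meet_mem[OF p(1) q(1)]] by auto
  qed
qed

end

sublocale stable_boolean_partition_algebra \<subseteq> S_star: partition_space_locale S N
  by (rule partition_space_locale.intro[OF partition_space_S_star])

section \<open>Separation and completeness of the space of \<open>F\<close>-ultrafilters\<close>

context stable_boolean_partition_algebra
begin

lemma separated_S_star: "separated (S, N)"
  unfolding separated.simps
proof (intro ballI impI)
  fix U V assume UV: "U \<in> S" "V \<in> S" "U \<noteq> V"
  then obtain a where a: "a \<in> U" "a \<notin> V"
    using F_ultrafilters_eqI[OF UV(1,2)] by auto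
  \<comment> \<open>Lying in \<open>U\<close> but not in \<open>V\<close> makes a nontrivial, so
    that a and its complement form a partition in \<open>F\<close>; its image separates
    \<open>U\<close> from \<open>V\<close>.\<close>
  then have "a \<in> carrier B" "a \<noteq> \<bottom>" "a \<noteq> \<top>"
    using F_ultrafilter_subset[OF UV(1)] F_ultrafilter_bottom[OF UV(1)] F_ultrafilter_top[OF UV(2)]
    by auto
  then have "\<iota> ` {a, complement B a} \<in> N"
    by (intro iota_partition_mem binary_mem)
  moreover have "\<not> (\<exists>R\<in>\<iota> ` {a, complement B a}. U \<in> R \<and> V \<in> R)"
    using a UV \<open>a \<in> carrier B\<close> F_ultrafilter_complement_iff
    by (auto simp: iota_def)
  ultimately show "\<exists>Z\<in>N. \<not> (\<exists>R\<in>Z. U \<in> R \<and> V \<in> R)"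
    by (rule bexI[rotated])
qed

text \<open>The limit of a Cauchy filter consists of the elements \<open>a\<close> such that \<open>\<iota> a\<close> is eventually reached.\<close>

lemma uniform_complete_S_star: "uniform_complete (uniform_of (S, N))"
  unfolding uniform_complete_def
proof (intro allI impI)
  fix \<F> assume "cauchy_filter_in (uniform_of (S, N)) \<F>"
  then have bot: "\<F> \<noteq> bot" and conc: "eventually (\<lambda>V. V \<in> S) \<F>"
    and cauchy: "\<And>Z. Z \<in> N \<Longrightarrow> \<exists>R\<in>Z. eventually (\<lambda>V. V \<in> R) \<F>"
    unfolding S_star.cauchy_filter_iff by (auto simp: le_principal)
  let ?U = "{a \<in> carrier B. eventually (\<lambda>V. V \<in> \<iota> a) \<F>}"
  have "\<bottom> \<notin> ?U"
    using bot by (auto simp: iota_bottom eventually_False)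
  moreover have "\<top> \<in> ?U"
    using conc by (simp add: iota_top)
  moreover have "a \<sqinter> b \<in> ?U" if "a \<in> ?U" "b \<in> ?U" for a b
    using that by (auto simp: iota_meet eventually_conj_iff)
  moreover have "b \<in> ?U" if "a \<in> ?U" "b \<in> carrier B" "a \<sqsubseteq> b" for a b
  proof -
    have "eventually (\<lambda>V. V \<in> \<iota> a) \<F>" using that(1) by simp
    then have "eventually (\<lambda>V. V \<in> \<iota> b) \<F>"
      by (rule eventually_mono) (use iota_mono[OF that(3,2)] in auto)
    with that(2) show ?thesis by simp
  qed
  \<comment> \<open>The Cauchy property for the image of p singles out a block
    \<open>\<iota> a\<close> that is eventually reached, and this a is the required element of
    p.\<close>
  moreover have "\<exists>a\<in>p. a \<in> ?U" if p: "p \<in> F" for p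
    using cauchy[OF iota_partition_mem[OF p]] partition_closed[OF mem_partitions[OF p]] by auto
  ultimately have U: "?U \<in> S"
    unfolding mem_F_ultrafilters_iff proper_filter_def by blast
  have "\<F> \<le> nhdsin (uniform_topology (uniform_of (S, N))) ?U"
    unfolding S_star.le_nhdsin_iff[OF U]
  proof (intro ballI impI)
    fix Z R assume Z: "Z \<in> N" "R \<in> Z" "?U \<in> R"
    then obtain p where p: "p \<in> F" "\<forall>a\<in>p. \<exists>R\<in>Z. \<iota> a \<subseteq> R"
      unfolding mem_S_star_iff by auto
    obtain a where a: "a \<in> p" "a \<in> ?U"
      using F_ultrafilter_block[OF U p(1)] by auto
    obtain R' where R': "R' \<in> Z" "\<iota> a \<subseteq> R'" using p(2) a(1) by auto
    have "?U \<in> \<iota> a" using U a(2) by (simp add: iota_def)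
    \<comment> \<open>The candidate limit lies in both blocks of \<open>Z\<close>, so the block
      absorbing \<open>\<iota> a\<close> is the given neighbourhood.\<close>
    then have "R' = R"
      using S_star.block_unique[OF Z(1) R'(1) Z(2) _ Z(3)] R'(2) by auto
    have "eventually (\<lambda>V. V \<in> \<iota> a) \<F>" using a(2) by simp
    then show "eventually (\<lambda>V. V \<in> R) \<F>"
      by (rule eventually_mono) (use R'(2) \<open>R' = R\<close> in auto)
  qed
  with U show "\<exists>V\<in>fst (uniform_of (S, N)). \<F> \<le> nhdsin (uniform_topology (uniform_of (S, N))) V"
    by simp (rule bexI)
qed

section \<open>\<open>\<iota>\<close> as a homomorphism into the algebra \<open>C\<close> of
  \<open>B_star (S_star (B, F))\<close>\<close>

abbreviation C :: "'a set set gorder" where "C \<equiv> set_lattice ({{}} \<union> \<Union>N)"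

lemma iota_closed:
  assumes "b \<in> carrier B"
  shows "\<iota> b \<in> {{}} \<union> \<Union>N"
proof (cases "b = \<bottom> \<or> b = \<top>")
  case True
  then show ?thesis
    using S_star.blocks.top iota_bottom iota_top by auto
next
  case False
  then show ?thesis
    using iota_partition_mem[OF binary_mem[OF assms]] by auto
qed

lemma boolean_hom_iota: "boolean_hom B C \<iota>"
  unfolding boolean_hom_def S_star.blocks.set_lattice_bottom S_star.blocks.set_lattice_top
proof (intro conjI ballI)
  show "\<iota> \<in> carrier B \<rightarrow> carrier C"
    using iota_closed by (intro funcsetI) simp
  fix a b assume ab: "a \<in> carrier B" "b \<in> carrier B"
  show "\<iota> (a \<sqinter> b) = \<iota> a \<sqinter>\<^bsub>C\<^esub> \<iota> b"
    using ab by (simp only: iota_meet S_star.blocks.set_lattice_meet iota_closed)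
  show "\<iota> (a \<squnion> b) = \<iota> a \<squnion>\<^bsub>C\<^esub> \<iota> b"
    using ab by (simp only: iota_join S_star.blocks.set_lattice_join iota_closed)
next
  fix a assume "a \<in> carrier B"
  then show "\<iota> (complement B a) = complement C (\<iota> a)"
    by (simp only: iota_complement S_star.blocks.set_lattice_complement iota_closed)
qed (rule iota_bottom iota_top)+

lemma partition_hom_iota: "partition_hom (B, F) (C, N) \<iota>"
proof -
  \<comment> \<open>By stability no \<open>\<iota> a\<close> with a in p is empty, so removing the
    empty set changes nothing.\<close>
  have "\<iota> ` p - {{}} \<in> N" if "p \<in> F" for p
    using iota_partition_mem[OF that] partition_onD3[OF iota_partition_on[OF that]]
    by simp
  then show ?thesis
    using boolean_hom_iota unfolding partition_hom.simps S_star.blocks.set_lattice_bottom by auto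
qed

end

section \<open>Subcomplete algebras and surjectivity of \<open>\<iota>\<close>\<close>

locale subcomplete_stable_boolean_partition_algebra = stable_boolean_partition_algebra +
  assumes subcomplete: "subcomplete (B, F)"
begin

text \<open>The join s of the chosen blocks could a priori have \<open>\<iota> s\<close> larger than
  the union of their images. It does not: the images of p cover the space, and each of them is
  contained in both \<open>R\<close> and \<open>\<iota> s\<close> or disjoint from both.\<close>

lemma iota_surj:
  assumes Z: "Z \<in> N" and R: "R \<in> Z"
  shows "\<exists>b\<in>carrier B. \<iota> b = R"
proof -
  obtain p where p: "p \<in> F" and ex: "\<And>a. a \<in> p \<Longrightarrow> \<exists>R\<in>Z. \<iota> a \<subseteq> R"
    using Z unfolding mem_S_star_iff by auto
  let ?r = "{a \<in> p. \<iota> a \<subseteq> R}"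
  have pc: "a \<in> carrier B" if "a \<in> p" for a
    using partition_closed[OF mem_partitions[OF p] that] .
  have "\<forall>r\<subseteq>p. \<exists>s. least B s (Upper B r)"
    using subcomplete p by (auto simp: subcomplete_partition_def)
  then obtain s where s: "least B s (Upper B ?r)" by (metis (no_types, lifting) mem_Collect_eq subsetI)
  then have sB: "s \<in> carrier B" by auto
  have upper: "a \<sqsubseteq> s" if "a \<in> ?r" for a
    using s pc that by (intro least_Upper_above[OF s]) auto
  have "\<iota> a \<subseteq> \<iota> s \<longleftrightarrow> \<iota> a \<subseteq> R" "\<iota> a \<inter> R \<noteq> {} \<Longrightarrow> \<iota> a \<subseteq> R" "\<iota> a \<inter> \<iota> s \<noteq> {} \<Longrightarrow> \<iota> a \<subseteq> R"
    if a: "a \<in> p" for a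
  proof -
    show *: "\<iota> a \<subseteq> R" if meets: "\<iota> a \<inter> R \<noteq> {}"
    proof -
      obtain R' where R': "R' \<in> Z" "\<iota> a \<subseteq> R'" using ex[OF a] by auto
      obtain V where "V \<in> \<iota> a" "V \<in> R" using meets by auto
      then have "R' = R" using S_star.block_unique[OF Z R'(1) R] R'(2) by auto
      with R' show ?thesis by simp
    qed
    show **: "\<iota> a \<subseteq> R" if "\<iota> a \<inter> \<iota> s \<noteq> {}"
    proof (rule ccontr)
      assume "\<not> \<iota> a \<subseteq> R"
      \<comment> \<open>An element a left out of the join is disjoint from every chosen block, so
        its complement is an upper bound of these blocks and hence lies above s.\<close>
      have "s \<sqsubseteq> complement B a"
      proof (rule least_le[OF s])
        have "b \<sqsubseteq> complement B a" if "b \<in> ?r" for b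
        proof -
          have "b \<noteq> a" using that \<open>\<not> \<iota> a \<subseteq> R\<close> by auto
          then have "b \<sqinter> a = \<bottom>"
            using that a partition_disjoint[OF mem_partitions[OF p]] by auto
          then show ?thesis
            using that a pc disjoint_iff_le_complement by auto
        qed
        then show "complement B a \<in> Upper B ?r"
          using pc[OF a] by (intro Upper_memI) (auto simp: complement_closed pc)
      qed
      then have "\<iota> s \<subseteq> S - \<iota> a"
        using iota_mono[of s "complement B a"] pc[OF a]
        by (simp add: iota_complement complement_closed)
      with that show False by auto
    qed
    show "\<iota> a \<subseteq> \<iota> s \<longleftrightarrow> \<iota> a \<subseteq> R"
    proof
      have "\<iota> a \<noteq> {}"
        using iota_partition_on[OF p] a by (auto simp: partition_on_def)
      moreover assume "\<iota> a \<subseteq> \<iota> s"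
      ultimately show "\<iota> a \<subseteq> R" by (intro **) auto
    next
      assume "\<iota> a \<subseteq> R"
      then show "\<iota> a \<subseteq> \<iota> s"
        using upper[of a] a iota_mono[OF _ sB] by auto
    qed
  qed
  note same = this
  have "\<iota> s = R"
  proof (rule Set.set_eqI)
    fix V
    show "V \<in> \<iota> s \<longleftrightarrow> V \<in> R"
    proof (cases "V \<in> S")
      case True
      then obtain a where a: "a \<in> p" "V \<in> \<iota> a"
        using Union_iota[OF p] by auto
      then show ?thesis
        using same[OF a(1)] by auto
    next
      case False
      then show ?thesis
        using iota_subset[of s] S_star.block_subset[OF Z R] by auto
    qed
  qed
  with sB show ?thesis by (rule bexI[rotated])
qed

lemma bij_betw_iota: "bij_betw \<iota> (carrier B) ({{}} \<union> \<Union>N)"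
  unfolding bij_betw_def
proof (intro conjI subset_antisym subsetI)
  show "R \<in> {{}} \<union> \<Union>N" if "R \<in> \<iota> ` carrier B" for R
    using that iota_closed by auto
  fix R assume "R \<in> {{}} \<union> \<Union>N"
  then consider "R = {}" | Z where "Z \<in> N" "R \<in> Z" by auto
  then show "R \<in> \<iota> ` carrier B"
  proof cases
    case 1
    then show ?thesis using iota_bottom bottom_closed by (metis imageI)
  next
    case 2
    then show ?thesis using iota_surj[OF 2] by auto
  qed
qed (rule inj_on_iota)

text \<open>Since \<open>\<iota>\<close> is an order embedding, disjointness, covering and
  refinement of \<open>Z\<close> pull back to the algebra. The pulled-back family is then in
  \<open>F\<close> because p refines it.\<close>

lemma partition_iso_iota: "partition_iso (B, F) (C, N) \<iota>"
proof -
  let ?g = "inv_into (carrier B) \<iota>"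
  have g: "?g R \<in> carrier B" "\<iota> (?g R) = R" if "R \<in> {{}} \<union> \<Union>N" for R
    using bij_betw_iota that by (auto simp: bij_betw_def inv_into_into f_inv_into_f)
  have "?g ` Z - {\<bottom>} \<in> F" if Z: "Z \<in> N" for Z
  proof -
    have gZ: "?g R \<in> carrier B" "\<iota> (?g R) = R" if "R \<in> Z" for R
      using g[of R] Z that by auto
    have nonbot: "?g R \<noteq> \<bottom>" if "R \<in> Z" for R
      using gZ[OF that] S_star.block_nonempty[OF Z that] iota_bottom by auto
    obtain p where p: "p \<in> F" and ex: "\<And>a. a \<in> p \<Longrightarrow> \<exists>R\<in>Z. \<iota> a \<subseteq> R"
      using Z unfolding mem_S_star_iff by auto
    have "?g ` Z \<in> F"
    proof (rule coarser_mem[OF p])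
      have "?g R \<sqinter> ?g R' = \<bottom>" if "R \<in> Z" "R' \<in> Z" "?g R \<noteq> ?g R'" for R R'
      proof -
        have "R \<inter> R' = {}"
          using that S_star.block_unique[OF Z that(1,2)] by auto
        then have "\<iota> (?g R \<sqinter> ?g R') = {}"
          using gZ[OF that(1)] gZ[OF that(2)] by (simp add: iota_meet)
        then show ?thesis
          using iota_nonempty[of "?g R \<sqinter> ?g R'"] gZ[OF that(1)] gZ[OF that(2)] by auto
      qed
      \<comment> \<open>If c bounds all preimages, then \<open>\<iota> c\<close> contains the union
        of \<open>Z\<close>, which is the whole space and thus the image of the top.\<close>
      moreover have "c = \<top>" if c: "c \<in> carrier B" "\<And>R. R \<in> Z \<Longrightarrow> ?g R \<sqsubseteq> c" for c
      proof -
        have "R \<subseteq> \<iota> c" if "R \<in> Z" for R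
          using iota_mono[OF c(2)[OF that] c(1)] gZ[OF that] by simp
        then have "\<Union>Z \<subseteq> \<iota> c" by (rule Union_least)
        moreover have "\<Union>Z = S"
          using S_star.partition_on[OF Z] by (simp add: partition_on_def)
        ultimately have "\<iota> \<top> \<subseteq> \<iota> c" by (simp add: iota_top)
        then show ?thesis
          using c(1) iota_subset_iff[OF top_closed c(1)] top_le_iff by simp
      qed
      ultimately show "?g ` Z \<in> partitions B"
        unfolding partitions_eq using gZ nonbot by auto
      show "finer B p (?g ` Z)"
        unfolding finer_def
      proof
        fix a assume a: "a \<in> p"
        obtain R where R: "R \<in> Z" "\<iota> a \<subseteq> R" using ex[OF a] by auto
        then have "a \<sqsubseteq> ?g R"
          using iota_subset_iff[of a "?g R"] gZ[OF R(1)] partition_closed[OF mem_partitions[OF p] a]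
          by simp
        with R(1) show "\<exists>b\<in>?g ` Z. a \<sqsubseteq> b" by auto
      qed
    qed
    moreover have "\<bottom> \<notin> ?g ` Z" using nonbot by (metis imageE)
    ultimately show ?thesis by simp
  qed
  moreover have "boolean_hom C B ?g"
    by (rule boolean_hom_inv_into[OF boolean_lattice_axioms S_star.blocks.boolean_lattice_set_lattice
          boolean_hom_iota]) (use bij_betw_iota in simp)
  ultimately show ?thesis
    unfolding partition_iso_def using bij_betw_iota partition_hom_iota by simp
qed

end

section \<open>The canonical map of a partition space\<close>

text \<open>The source uniformity is arbitrary. This is needed for the inverse of an embedding,
  whose domain carries a subspace uniformity not given by partitions.\<close>

lemma uniformly_continuous_into:
  "uniformly_continuous (X, \<U>) (uniform_of (Y, N)) f \<longleftrightarrow>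
     f \<in> X \<rightarrow> Y \<and> (\<forall>Q\<in>N. eventually (\<lambda>(x, y). \<exists>T\<in>Q. f x \<in> T \<and> f y \<in> T) \<U>)"
  by (simp add: filterlim_INF filterlim_principal split_beta')

context partition_space_locale
begin

abbreviation A :: "'b set gorder" where "A \<equiv> set_lattice ({{}} \<union> \<Union>M)"

abbreviation \<C> :: "'b \<Rightarrow> 'b set set" where "\<C> \<equiv> point_ultrafilter (X, M)"

text \<open>From here on \<open>A.S\<close> and \<open>A.N\<close> are the points and partitions of
  \<open>S_star (B_star (X, M))\<close>, and \<open>A.\<iota> R\<close> collects the ultrafilters
  containing the set \<open>R\<close>.\<close>

interpretation A: stable_boolean_partition_algebra A M
  using boolean_partition_algebra_B_star stable_B_star by unfold_locales simp_all

lemma S_star_B_star: "S_star (B_star (X, M)) = (F_ultrafilters (A, M), snd (S_star (A, M)))"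
  unfolding B_star.simps by (rule A.S_star_eq)

lemma mem_point_ultrafilter: "R \<in> \<C> x \<longleftrightarrow> R \<in> {{}} \<union> \<Union>M \<and> x \<in> R"
  by (auto simp: point_ultrafilter_def)

text \<open>The sets of the algebra containing x form a proper filter, and it meets every partition
  in the block around x.\<close>

lemma point_ultrafilter_closed:
  assumes "x \<in> X"
  shows "\<C> x \<in> A.S"
proof -
  have "X \<in> \<C> x"
    using assms blocks.top by (simp only: mem_point_ultrafilter)
  then have "\<C> x \<noteq> {}" by auto
  moreover have "R \<sqinter>\<^bsub>A\<^esub> T \<in> \<C> x" if "R \<in> \<C> x" "T \<in> \<C> x" for R T
  proof -
    have RT: "R \<in> {{}} \<union> \<Union>M" "T \<in> {{}} \<union> \<Union>M" "x \<in> R \<inter> T"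
      using that unfolding mem_point_ultrafilter by auto
    then show ?thesis
      unfolding mem_point_ultrafilter blocks.set_lattice_meet[OF RT(1,2)]
      using blocks.Int[OF RT(1,2)] by (intro conjI)
  qed
  moreover have "\<exists>R\<in>P. R \<in> \<C> x" if "P \<in> M" for P
    using block_exists[OF that assms] that unfolding mem_point_ultrafilter by auto
  ultimately show ?thesis
    unfolding A.mem_F_ultrafilters_iff proper_filter_def blocks.set_lattice_bottom
  proof (intro conjI ballI impI)
    show "T \<in> \<C> x" if "R \<in> \<C> x" "T \<in> carrier A" "R \<sqsubseteq>\<^bsub>A\<^esub> T" for R T
      using that by (auto simp: mem_point_ultrafilter)
  qed (auto simp: mem_point_ultrafilter)
qed

text \<open>This pullback formula drives continuity, density and the continuity of the
  inverse.\<close>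

lemma point_ultrafilter_mem_iota:
  "x \<in> X \<Longrightarrow> R \<in> {{}} \<union> \<Union>M \<Longrightarrow> \<C> x \<in> A.\<iota> R \<longleftrightarrow> x \<in> R"
  unfolding iota_def using point_ultrafilter_closed mem_point_ultrafilter[of R x] by simp

lemma uniformly_continuous_point_ultrafilter:
  "uniformly_continuous (uniform_of (X, M)) (uniform_of (A.S, A.N)) \<C>"
proof -
  have "eventually (\<lambda>(x, y). \<exists>T\<in>Z. \<C> x \<in> T \<and> \<C> y \<in> T) (snd (uniform_of (X, M)))"
    if Z: "Z \<in> A.N" for Z
    unfolding eventually_uniform_of[OF partition_space] prod.case
  proof -
    \<comment> \<open>The partition \<open>P\<close> whose image refines \<open>Z\<close> serves
      directly as modulus: points of one block \<open>R\<close> go to \<open>A.\<iota> R\<close>,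
      which lies in one block of \<open>Z\<close>.\<close>
    obtain P where P: "P \<in> M" "\<And>R. R \<in> P \<Longrightarrow> \<exists>T\<in>Z. A.\<iota> R \<subseteq> T"
      using Z unfolding A.mem_S_star_iff by auto
    show "\<exists>P\<in>M. \<forall>R\<in>P. \<forall>x\<in>R. \<forall>y\<in>R. \<exists>T\<in>Z. \<C> x \<in> T \<and> \<C> y \<in> T"
    proof (intro bexI[OF _ P(1)] ballI)
      fix R x y assume R: "R \<in> P" "x \<in> R" "y \<in> R"
      obtain T where T: "T \<in> Z" "A.\<iota> R \<subseteq> T" using P(2)[OF R(1)] by auto
      have "R \<in> {{}} \<union> \<Union>M" "x \<in> X" "y \<in> X"
        using P(1) R block_subset[OF P(1) R(1)] by auto
      then have "\<C> x \<in> A.\<iota> R" "\<C> y \<in> A.\<iota> R"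
        using R by (simp_all only: point_ultrafilter_mem_iota)
      with T show "\<exists>T\<in>Z. \<C> x \<in> T \<and> \<C> y \<in> T" by auto
    qed
  qed
  then show ?thesis
    using uniformly_continuous_into[of X "snd (uniform_of (X, M))" A.S A.N \<C>] point_ultrafilter_closed
    by simp
qed

lemma dense_point_ultrafilter:
  "uniform_topology (uniform_of (A.S, A.N)) closure_of (\<C> ` X) = A.S"
proof (rule A.S_star.closure_eq_spaceI)
  show "\<C> ` X \<subseteq> A.S"
    using point_ultrafilter_closed by auto
  fix Z T assume Z: "Z \<in> A.N" "T \<in> Z"
  then obtain P where P: "P \<in> M" "\<And>R. R \<in> P \<Longrightarrow> \<exists>T\<in>Z. A.\<iota> R \<subseteq> T"
    unfolding A.mem_S_star_iff by auto
  \<comment> \<open>A member \<open>U\<close> of \<open>T\<close> determines a block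
    \<open>R\<close> of \<open>P\<close> with \<open>A.\<iota> R\<close> inside \<open>T\<close>;
    any point of \<open>R\<close> is then mapped into \<open>T\<close>.\<close>
  obtain U where U: "U \<in> T" "U \<in> A.S"
    using A.S_star.block_nonempty[OF Z] A.S_star.block_subset[OF Z] by auto
  obtain R where R: "R \<in> P" "U \<in> A.\<iota> R"
    using A.Union_iota[OF P(1)] U(2) by auto
  obtain T' where T': "T' \<in> Z" "A.\<iota> R \<subseteq> T'" using P(2)[OF R(1)] by auto
  then have "T' = T"
    using A.S_star.block_unique[OF Z(1) T'(1) Z(2) _ U(1)] R(2) by auto
  obtain x where x: "x \<in> R" using block_nonempty[OF P(1) R(1)] by auto
  then have "x \<in> X" "R \<in> {{}} \<union> \<Union>M"
    using block_subset[OF P(1) R(1)] P(1) R(1) by auto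
  then have "\<C> x \<in> A.\<iota> R" using x by (simp only: point_ultrafilter_mem_iota)
  with T' \<open>T' = T\<close> \<open>x \<in> X\<close> show "\<C> ` X \<inter> T \<noteq> {}" by auto
qed

section \<open>Separated and complete partition spaces\<close>

lemma inj_on_point_ultrafilter:
  assumes "separated (X, M)"
  shows "inj_on \<C> X"
proof (rule inj_onI, rule ccontr)
  fix x y assume xy: "x \<in> X" "y \<in> X" "\<C> x = \<C> y" "x \<noteq> y"
  then obtain P where P: "P \<in> M" "\<not> (\<exists>R\<in>P. x \<in> R \<and> y \<in> R)"
    using assms by (metis separated.simps)
  obtain R where R: "R \<in> P" "x \<in> R" using block_exists[OF P(1) xy(1)] by auto
  then have "R \<in> \<C> x"
    using P(1) unfolding mem_point_ultrafilter by auto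
  then have "y \<in> R"
    unfolding xy(3) mem_point_ultrafilter by simp
  with P(2) R show False by auto
qed

lemma uniform_embedding_point_ultrafilter:
  assumes "separated (X, M)"
  shows "uniform_embedding (uniform_of (X, M)) (uniform_of (A.S, A.N)) \<C>"
proof -
  let ?g = "inv_into X \<C>"
  let ?\<V> = "snd (uniform_of (A.S, A.N))"
  let ?I = "\<C> ` X \<times> \<C> ` X"
  have g: "?g (\<C> x) = x" if "x \<in> X" for x
    using inj_on_point_ultrafilter[OF assms] that by (rule inv_into_f_f)
  have lim: "filterlim (\<lambda>(x, y). (\<C> x, \<C> y)) ?\<V> (snd (uniform_of (X, M)))"
    using uniformly_continuous_point_ultrafilter by simp
  \<comment> \<open>Convergence to the subspace uniformity also requires the image pairs to be
    eventually in the square of the image.\<close>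
  have "eventually (\<lambda>z. (case z of (x, y) \<Rightarrow> (\<C> x, \<C> y)) \<in> ?I) (snd (uniform_of (X, M)))"
  proof -
    obtain P where P: "P \<in> M" using nonempty by auto
    show ?thesis
      unfolding eventually_uniform_of[OF partition_space] prod.case
      by (rule bexI[OF _ P]) (use block_subset[OF P] in auto)
  qed
  with lim have "filterlim (\<lambda>(x, y). (\<C> x, \<C> y)) (Lattices.inf ?\<V> (principal ?I)) (snd (uniform_of (X, M)))"
    unfolding filterlim_inf filterlim_principal by (rule conjI)
  then have cont: "uniformly_continuous (uniform_of (X, M)) (uniform_subspace (uniform_of (A.S, A.N)) (\<C> ` X)) \<C>"
    by simp
  \<comment> \<open>For the inverse, the image of \<open>P\<close> under \<open>A.\<iota>\<close> is
    itself a partition of the target; two image points in one \<open>A.\<iota> R\<close> come from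
    two points of \<open>R\<close>.\<close>
  have "eventually (\<lambda>(u, v). \<exists>R\<in>P. ?g u \<in> R \<and> ?g v \<in> R) (Lattices.inf ?\<V> (principal ?I))"
    if P: "P \<in> M" for P
    unfolding eventually_inf_principal eventually_uniform_of[OF A.S_star.partition_space]
  proof (intro bexI[OF _ A.iota_partition_mem[OF P]] ballI impI)
    fix T u v assume T: "T \<in> A.\<iota> ` P" "u \<in> T" "v \<in> T" and uv: "(u, v) \<in> ?I"
    obtain R where R: "R \<in> P" "T = A.\<iota> R" using T(1) by auto
    obtain x y where xy: "x \<in> X" "y \<in> X" "u = \<C> x" "v = \<C> y" using uv by auto
    have "R \<in> {{}} \<union> \<Union>M" using R(1) P by auto
    then have "x \<in> R" "y \<in> R"
      using T(2,3) point_ultrafilter_mem_iota[of _ R] unfolding R(2) xy(3,4) using xy(1,2) by auto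
    with R(1) xy show "case (u, v) of (u, v) \<Rightarrow> \<exists>R\<in>P. ?g u \<in> R \<and> ?g v \<in> R"
      by (auto simp: g)
  qed
  moreover have "?g \<in> \<C> ` X \<rightarrow> X"
    using g by auto
  ultimately have "uniformly_continuous (uniform_subspace (uniform_of (A.S, A.N)) (\<C> ` X)) (uniform_of (X, M)) ?g"
    using uniformly_continuous_into[of "\<C> ` X" "Lattices.inf ?\<V> (principal ?I)" X M ?g] by simp
  with cont inj_on_point_ultrafilter[OF assms] show ?thesis
    unfolding uniform_embedding_def uniform_homeomorphism_def
    using point_ultrafilter_closed by (simp add: inj_on_imp_bij_betw)
qed

text \<open>
  An \<open>F\<close>-ultrafilter on the algebra of blocks is a filter base of a Cauchy filter on \<open>X\<close>, and it
  is the point ultrafilter of any limit of this filter.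
\<close>

lemma point_ultrafilter_surj:
  assumes "uniform_complete (uniform_of (X, M))" and U: "U \<in> A.S"
  shows "U \<in> \<C> ` X"
proof -
  have UA: "R \<in> {{}} \<union> \<Union>M" if "R \<in> U" for R
    using A.F_ultrafilter_subset[OF U that] by simp
  have "U \<noteq> {}" and "{} \<notin> U"
    using U A.F_ultrafilter_bottom[OF U] unfolding A.mem_F_ultrafilters_iff proper_filter_def
      blocks.set_lattice_bottom by auto
  have up: "T \<in> U" if "R \<in> U" "T \<in> {{}} \<union> \<Union>M" "R \<subseteq> T" for R T
    using A.F_ultrafilter_up[OF U that(1), of T] that by simp
  have inter: "R \<inter> T \<in> U" if "R \<in> U" "T \<in> U" for R T
    using A.F_ultrafilter_meet_iff[OF U, of R T] that UA
      blocks.set_lattice_meet[OF UA[OF that(1)] UA[OF that(2)]] by simp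
  \<comment> \<open>\<open>U\<close> is closed under intersections, so its members are a base of
    this filter on \<open>X\<close> and not merely a subbase.\<close>
  define \<F> where "\<F> = (INF R\<in>U. principal R)"
  have ev: "eventually E \<F> \<longleftrightarrow> (\<exists>R\<in>U. \<forall>x\<in>R. E x)" for E
  proof -
    have "\<exists>T\<in>U. principal T \<le> Lattices.inf (principal R) (principal R')"
      if "R \<in> U" "R' \<in> U" for R R'
      using inter[OF that] by (intro bexI[of _ "R \<inter> R'"]) auto
    then show ?thesis
      unfolding \<F>_def by (subst eventually_INF_base[OF \<open>U \<noteq> {}\<close>]) (auto simp: eventually_principal)
  qed
  have "cauchy_filter_in (uniform_of (X, M)) \<F>"
    unfolding cauchy_filter_iff
  proof (intro conjI ballI)
    show "\<F> \<noteq> bot"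
      using \<open>{} \<notin> U\<close> by (auto simp: trivial_limit_def ev)
    obtain R where "R \<in> U" using \<open>U \<noteq> {}\<close> by auto
    then show "\<F> \<le> principal X"
      unfolding le_principal ev using blocks.sets_into_space[OF UA] by auto
    fix P assume "P \<in> M"
    then obtain R where "R \<in> P" "R \<in> U"
      using A.F_ultrafilter_block[OF U] by auto
    then show "\<exists>R\<in>P. eventually (\<lambda>x. x \<in> R) \<F>"
      unfolding ev by auto
  qed
  then obtain x where x: "x \<in> X" "\<F> \<le> nhdsin (uniform_topology (uniform_of (X, M))) x"
    using assms(1) unfolding uniform_complete_def by auto
  \<comment> \<open>One inclusion suffices, since comparable \<open>F\<close>-ultrafilters
    coincide.\<close>
  have "\<C> x \<subseteq> U"
  proof
    fix R assume "R \<in> \<C> x"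
    then obtain P where P: "P \<in> M" "R \<in> P" "x \<in> R"
      unfolding mem_point_ultrafilter by auto
    then have "eventually (\<lambda>y. y \<in> R) \<F>"
      using x(2) unfolding le_nhdsin_iff[OF x(1)] by auto
    then obtain T where "T \<in> U" "T \<subseteq> R"
      unfolding ev by auto
    with P show "R \<in> U"
      by (intro up[of T R]) auto
  qed
  then have "\<C> x = U"
    by (rule A.F_ultrafilters_eqI[OF point_ultrafilter_closed[OF x(1)] U])
  with x(1) show ?thesis by auto
qed

text \<open>Completeness makes the image the whole space, so the embedding lands in the full
  uniformity.\<close>

lemma uniform_homeomorphism_point_ultrafilter:
  assumes "complete_space (X, M)"
  shows "uniform_homeomorphism (uniform_of (X, M)) (uniform_of (A.S, A.N)) \<C>"
proof -
  have "\<C> ` X = A.S"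
    using point_ultrafilter_surj point_ultrafilter_closed assms
    unfolding complete_space_def by auto
  moreover have "fst (uniform_of (X, M)) = X"
    by simp
  moreover have "separated (X, M)"
    using assms by (simp add: complete_space_def)
  ultimately show ?thesis
    using uniform_embedding_point_ultrafilter A.S_star.uniform_subspace_space
    unfolding uniform_embedding_def by metis
qed

end

theorem theorem2p3:
  fixes B :: "'a gorder" and F :: "'a set set"
    and X :: "'b set" and M :: "'b set set set"
  shows
    "(boolean_partition_algebra (B, F) \<and> stable (B, F) \<longrightarrow>
        partition_space (S_star (B, F)) \<and> complete_space (S_star (B, F))) \<and>
     (partition_space (X, M) \<longrightarrow>
        boolean_partition_algebra (B_star (X, M)) \<and>
        subcomplete (B_star (X, M)) \<and> stable (B_star (X, M))) \<and>
     (boolean_partition_algebra (B, F) \<and> stable (B, F) \<longrightarrow>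
        inj_on (iota (B, F)) (carrier B) \<and>
        partition_hom (B, F) (B_star (S_star (B, F))) (iota (B, F)) \<and>
        (subcomplete (B, F) \<longrightarrow>
           partition_iso (B, F) (B_star (S_star (B, F))) (iota (B, F)))) \<and>
     (partition_space (X, M) \<longrightarrow>
        uniformly_continuous (uniform_of (X, M)) (uniform_of (S_star (B_star (X, M))))
          (point_ultrafilter (X, M)) \<and>
        uniform_topology (uniform_of (S_star (B_star (X, M))))
            closure_of (point_ultrafilter (X, M) ` X) = fst (S_star (B_star (X, M))) \<and>
        (separated (X, M) \<longrightarrow>
           uniform_embedding (uniform_of (X, M)) (uniform_of (S_star (B_star (X, M))))
             (point_ultrafilter (X, M))) \<and>
        (complete_space (X, M) \<longrightarrow>
           uniform_homeomorphism (uniform_of (X, M)) (uniform_of (S_star (B_star (X, M))))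
             (point_ultrafilter (X, M))))"
proof (intro conjI impI)
  assume BF: "boolean_partition_algebra (B, F) \<and> stable (B, F)"
  interpret stable_boolean_partition_algebra B F
    by unfold_locales (rule BF[THEN conjunct1] BF[THEN conjunct2])+
  show "partition_space (S_star (B, F))"
    by (subst S_star_eq) (rule partition_space_S_star)
  show "complete_space (S_star (B, F))"
    by (subst S_star_eq) (simp only: complete_space_def separated_S_star uniform_complete_S_star)
  show "inj_on (iota (B, F)) (carrier B)"
    by (rule inj_on_iota)
  show "partition_hom (B, F) (B_star (S_star (B, F))) (iota (B, F))"
    by (subst S_star_eq, subst B_star.simps) (rule partition_hom_iota)
  assume "subcomplete (B, F)"
  then interpret subcomplete_stable_boolean_partition_algebra B F
    by unfold_locales
  show "partition_iso (B, F) (B_star (S_star (B, F))) (iota (B, F))"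
    by (subst S_star_eq, subst B_star.simps) (rule partition_iso_iota)
next
  assume "partition_space (X, M)"
  then interpret partition_space_locale X M
    by unfold_locales
  show "boolean_partition_algebra (B_star (X, M))" "subcomplete (B_star (X, M))" "stable (B_star (X, M))"
    by (fact boolean_partition_algebra_B_star subcomplete_B_star stable_B_star)+
  show "uniformly_continuous (uniform_of (X, M)) (uniform_of (S_star (B_star (X, M)))) (point_ultrafilter (X, M))"
    unfolding S_star_B_star by (rule uniformly_continuous_point_ultrafilter)
  show "uniform_topology (uniform_of (S_star (B_star (X, M)))) closure_of (point_ultrafilter (X, M) ` X) =
      fst (S_star (B_star (X, M)))"
    unfolding S_star_B_star fst_conv by (rule dense_point_ultrafilter)
  show "uniform_embedding (uniform_of (X, M)) (uniform_of (S_star (B_star (X, M)))) (point_ultrafilter (X, M))"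
    if "separated (X, M)"
    unfolding S_star_B_star using that by (rule uniform_embedding_point_ultrafilter)
  show "uniform_homeomorphism (uniform_of (X, M)) (uniform_of (S_star (B_star (X, M)))) (point_ultrafilter (X, M))"
    if "complete_space (X, M)"
    unfolding S_star_B_star using that by (rule uniform_homeomorphism_point_ultrafilter)
qed

end
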